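(* Let $n\ge 2$ and let $X\subset\Omega_n$ be a subshift. The following conditions are equivalent: (1) There exists a point $\omega\in X$ such that $BD^*(\{j\in\mathbb{N}:\omega_j=\alpha\})>0$ for some $\alpha\in\Lambda_n\setminus\{0\}$. (2) There exists a shift invariant measure $\mu$ on $X$ such that $\mu([\alpha]_X)>0$ for some $\alpha\in\Lambda_n\setminus\{0\}$. (3) There exists a shift invariant ergodic measure $\mu_e$ on $X$ such that $\mu_e([\alpha]_X)>0$ for some $\alpha\in\Lambda_n\setminus\{0\}$. (4) There exists a point $\omega\in X$ such that the asymptotic density $d(\{j\in\mathbb{N}:\omega_j=\alpha\})$ exists and is positive for some $\alpha\in\Lambda_n\setminus\{0\}$. Moreover, if $X$ has positive topological entropy, then all the conditions (1)-(4) hold; and if $X$ is a hereditary subshift, then each of the conditions (1)-(4) is equivalent to $h(X)>0$.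
   Context: $\mathbb{N}=\{1,2,\ldots\}$. For $n\ge 2$, $\Lambda_n=\{0,1,\ldots,n-1\}$ has the discrete topology and $\Omega_n=\Lambda_n^{\mathbb{N}}$ the product topology; $\sigma\colon\Omega_n\to\Omega_n$, $(\sigma(\omega))_i=\omega_{i+1}$, is the shift. A subshift is a nonempty closed set $X\subset\Omega_n$ with $\sigma(X)\subset X$. A subshift $X\subset\Omega_n$ is hereditary if whenever $\omega\in X$, $\omega'\in\Omega_n$ and $\omega'_i\le\omega_i$ for all $i\in\mathbb{N}$, then $\omega'\in X$. $[\alpha]_X=\{\omega\in X:\omega_1=\alpha\}$. Invariant measures are $\sigma$-invariant Borel probability measures on $X$. $\mathcal{L}_k(X)$ is the set of words of length $k$ appearing (as blocks of consecutive symbols) in some element of $X$, and the topological entropy is $h(X)=\lim_{k\to\infty}\frac{1}{k}\log\#\mathcal{L}_k(X)$ (logarithm base 2). For $A\subset\mathbb{N}$, the upper Banach density is $BD^*(A)=\limsup_{n-m\to\infty}\frac{\#(A\cap\{m,m+1,\ldots,n-1\})}{n-m}$, and the asymptotic density is $d(A)=\lim_{n\to\infty}\frac{\#(A\cap\{1,\ldots,n\})}{n}$ when this limit exists. *)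

theory Defs
  imports "HOL-Probability.Probability"
begin

text \<open>
  A one-sided sequence is a function from \<open>nat\<close>, so \<open>\<omega> i\<close> is the symbol usually written with
  index \<open>i + 1\<close>. Sets of positions and their densities stay within the positive integers;
  \<open>positions\<close> performs the index translation.
\<close>

definition alphabet :: "nat \<Rightarrow> nat set" where
  "alphabet n = {..<n}"

definition full_shift :: "nat \<Rightarrow> (nat \<Rightarrow> nat) set" where
  "full_shift n = {\<omega>. \<forall>i. \<omega> i \<in> alphabet n}"

definition shift :: "(nat \<Rightarrow> nat) \<Rightarrow> (nat \<Rightarrow> nat)" where
  "shift \<omega> = (\<lambda>i. \<omega> (Suc i))"

text \<open>
  The type \<open>nat \<Rightarrow> nat\<close> carries the product of the discrete topologies; its subspace topology on
  \<open>full_shift n\<close> is the product topology of the finite discrete alphabets.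
\<close>

definition subshift :: "nat \<Rightarrow> (nat \<Rightarrow> nat) set \<Rightarrow> bool" where
  "subshift n X \<longleftrightarrow>
     X \<noteq> {} \<and> closedin (top_of_set (full_shift n)) X \<and> shift ` X \<subseteq> X"

definition hereditary :: "nat \<Rightarrow> (nat \<Rightarrow> nat) set \<Rightarrow> bool" where
  "hereditary n X \<longleftrightarrow>
     (\<forall>\<omega>\<in>X. \<forall>\<omega>'\<in>full_shift n. (\<forall>i. \<omega>' i \<le> \<omega> i) \<longrightarrow> \<omega>' \<in> X)"

definition cylinder :: "(nat \<Rightarrow> nat) set \<Rightarrow> nat \<Rightarrow> (nat \<Rightarrow> nat) set" where
  "cylinder X \<alpha> = {\<omega>\<in>X. \<omega> 0 = \<alpha>}"

definition invariant_measure :: "(nat \<Rightarrow> nat) set \<Rightarrow> (nat \<Rightarrow> nat) measure \<Rightarrow> bool" where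
  "invariant_measure X \<mu> \<longleftrightarrow>
     prob_space \<mu> \<and> sets \<mu> = sets (restrict_space borel X) \<and>
     (\<forall>A\<in>sets \<mu>. measure \<mu> (shift -` A \<inter> X) = measure \<mu> A)"

definition ergodic_measure :: "(nat \<Rightarrow> nat) set \<Rightarrow> (nat \<Rightarrow> nat) measure \<Rightarrow> bool" where
  "ergodic_measure X \<mu> \<longleftrightarrow>
     invariant_measure X \<mu> \<and>
     (\<forall>A\<in>sets \<mu>. shift -` A \<inter> X = A \<longrightarrow> measure \<mu> A = 0 \<or> measure \<mu> A = 1)"

definition language :: "(nat \<Rightarrow> nat) set \<Rightarrow> nat \<Rightarrow> nat list set" where
  "language X k = {map \<omega> [i..<i + k] | \<omega> i. \<omega> \<in> X}"

text \<open>
  For a subshift the limit exists by subadditivity (Fekete's lemma), so \<open>lim\<close> is not applied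
  outside its domain.
\<close>

definition top_entropy :: "(nat \<Rightarrow> nat) set \<Rightarrow> real" where
  "top_entropy X = lim (\<lambda>k. log 2 (real (card (language X k))) / real k)"

definition positions :: "(nat \<Rightarrow> nat) \<Rightarrow> nat \<Rightarrow> nat set" where
  "positions \<omega> \<alpha> = {j. 1 \<le> j \<and> \<omega> (j - 1) = \<alpha>}"

text \<open>
  The filter below is generated by the sets of pairs \<open>(m, n)\<close> with \<open>1 \<le> m < n\<close> and
  \<open>n - m \<ge> N\<close>, so the density is the infimum over \<open>N\<close> of the suprema over these sets.
\<close>

definition upper_Banach_density :: "nat set \<Rightarrow> ereal" where
  "upper_Banach_density A =
     Limsup (inf (filtercomap (\<lambda>(m, n). n - m) at_top) (principal {(m, n). 1 \<le> m \<and> m < n}))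
       (\<lambda>(m, n). ereal (real (card (A \<inter> {m..<n})) / real (n - m)))"

definition has_asymptotic_density :: "nat set \<Rightarrow> real \<Rightarrow> bool" where
  "has_asymptotic_density A d \<longleftrightarrow>
     (\<lambda>n. real (card (A \<inter> {1..n})) / real n) \<longlonglongrightarrow> d"

definition pos_Banach_density_point :: "nat \<Rightarrow> (nat \<Rightarrow> nat) set \<Rightarrow> bool" where
  "pos_Banach_density_point n X \<longleftrightarrow>
     (\<exists>\<omega>\<in>X. \<exists>\<alpha>\<in>alphabet n - {0}. upper_Banach_density (positions \<omega> \<alpha>) > 0)"

definition pos_invariant_measure :: "nat \<Rightarrow> (nat \<Rightarrow> nat) set \<Rightarrow> bool" where
  "pos_invariant_measure n X \<longleftrightarrow>
     (\<exists>\<mu>. invariant_measure X \<mu> \<and> (\<exists>\<alpha>\<in>alphabet n - {0}. measure \<mu> (cylinder X \<alpha>) > 0))"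

definition pos_ergodic_measure :: "nat \<Rightarrow> (nat \<Rightarrow> nat) set \<Rightarrow> bool" where
  "pos_ergodic_measure n X \<longleftrightarrow>
     (\<exists>\<mu>. ergodic_measure X \<mu> \<and> (\<exists>\<alpha>\<in>alphabet n - {0}. measure \<mu> (cylinder X \<alpha>) > 0))"

definition pos_asymptotic_density_point :: "nat \<Rightarrow> (nat \<Rightarrow> nat) set \<Rightarrow> bool" where
  "pos_asymptotic_density_point n X \<longleftrightarrow>
     (\<exists>\<omega>\<in>X. \<exists>\<alpha>\<in>alphabet n - {0}. \<exists>d>0. has_asymptotic_density (positions \<omega> \<alpha>) d)"

end

theory Submission
  imports Defs
begin

text \<open>
  Everything reduces to positivity of the maximal frequency of a symbol \<open>\<alpha>\<close>: let \<open>max_occ \<alpha> k\<close> be the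
  largest number of occurrences of \<open>\<alpha>\<close> in a word of length \<open>k\<close> of \<open>X\<close>, and let \<open>max_freq \<alpha>\<close> be the
  limit of \<open>max_occ \<alpha> k / k\<close>, which exists by subadditivity. A combinatorial argument and compactness
  give a point all of whose prefixes have frequency at least \<open>max_freq \<alpha>\<close>; in this point \<open>\<alpha>\<close> has
  asymptotic density exactly \<open>max_freq \<alpha>\<close>, so the pointwise ergodic theorem is not needed. The
  empirical frequencies along this point accumulate at an invariant measure. Maximizing over all
  invariant measures first the measure of the cylinder of \<open>\<alpha>\<close> and then, one after the other, the
  measures of all cylinders yields an extreme, hence ergodic measure. Conversely, integrating the
  number of occurrences bounds the measure of the cylinder by \<open>max_freq \<alpha>\<close>. If all nonzero symbols
  have maximal frequency zero, almost all symbols of every long word are zero, and the entropy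
  vanishes; in a hereditary subshift, the occurrences of a nonzero \<open>\<alpha>\<close> can be replaced
  independently by zeros, which produces \<open>2 ^ max_occ \<alpha> k\<close> words of length \<open>k\<close>.
\<close>

section \<open>Subadditive sequences and cylinder sets\<close>

text \<open>Choose \<open>m\<close> with \<open>a m / m\<close> close to the infimum
  \<open>L\<close> and divide \<open>n\<close> by \<open>m\<close> with remainder: the remainder
  contributes a bounded amount, which vanishes after division by \<open>n\<close>. Since the limit
  is the infimum, it also bounds every single term, which is the second conclusion.\<close>

lemma fekete:
  fixes a :: "nat \<Rightarrow> real"
  assumes sub: "\<And>m n. a (m + n) \<le> a m + a n" and nonneg: "\<And>n. 0 \<le> a n"
  obtains L where "(\<lambda>n. a n / real n) \<longlonglongrightarrow> L" and "\<And>n. L * real n \<le> a n"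
proof -
  define L where "L = Inf ((\<lambda>n. a n / real n) ` {1..})"
  have bdd: "bdd_below ((\<lambda>n. a n / real n) ` {1..})"
    by (rule bdd_belowI[of _ 0]) (auto simp: nonneg)
  have L_le: "L \<le> a n / real n" if "n \<ge> 1" for n
    unfolding L_def using that by (intro cInf_lower bdd) auto
  have mult: "a (q * m + r) \<le> real q * a m + a r" for q m r
  proof (induction q)
    case (Suc q)
    have "a (Suc q * m + r) = a (m + (q * m + r))" by (simp add: algebra_simps)
    also have "\<dots> \<le> a m + a (q * m + r)" by (rule sub)
    finally show ?case using Suc by (simp add: algebra_simps)
  qed simp
  have "(\<lambda>n. a n / real n) \<longlonglongrightarrow> L"
  proof (rule LIMSEQ_I)
    fix e :: real assume e: "0 < e"
    have "\<exists>y\<in>(\<lambda>n. a n / real n) ` {1..}. y < L + e / 2"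
      using e unfolding L_def by (intro cInf_lessD) auto
    then obtain m where m: "m \<ge> 1" "a m / real m < L + e / 2" by auto
    define C where "C = (\<Sum>r<m. a r)"
    have C: "a r \<le> C" if "r < m" for r
      unfolding C_def using that by (intro member_le_sum) (auto simp: nonneg)
    obtain N where N: "real N > 2 * C / e" using reals_Archimedean2 by blast
    show "\<exists>no. \<forall>n\<ge>no. norm (a n / real n - L) < e"
    proof (intro exI[of _ "max N 1"] allI impI)
      fix n assume n: "n \<ge> max N 1"
      have "a n \<le> real (n div m) * a m + a (n mod m)"
        using mult[of "n div m" m "n mod m"] by simp
      also have "real (n div m) * a m = real (n div m * m) * (a m / real m)"
        using m by simp
      also have "\<dots> \<le> real n * (a m / real m)"
        using nonneg[of m] by (intro mult_right_mono) (auto simp flip: of_nat_mult)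
      finally have "a n \<le> real n * (a m / real m) + C"
        using C[of "n mod m"] m by auto
      then have "a n / real n \<le> a m / real m + C / real n"
        using n by (simp add: field_simps)
      moreover have "C / real n < e / 2"
      proof -
        have "2 * C / e < real n" using N n by linarith
        then show ?thesis using e n by (simp add: field_simps)
      qed
      ultimately have "a n / real n < L + e" using m(2) by linarith
      moreover have "L \<le> a n / real n" using n by (intro L_le) auto
      ultimately show "norm (a n / real n - L) < e" by auto
    qed
  qed
  moreover have "L * real n \<le> a n" for n
    using L_le[of n] nonneg[of n] by (cases "n = 0") (auto simp: field_simps)
  ultimately show ?thesis by (rule that)
qed

text \<open>Tychonoff's theorem, used for the full shift and for the cube of functions from words to
  the unit interval.\<close>

lemma compact_box:
  fixes B :: "'i \<Rightarrow> 'b::topological_space set"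
  assumes "\<And>i. compact (B i)"
  shows "compact {f. \<forall>i. f i \<in> B i}"
proof -
  have "compactin (product_topology (\<lambda>i. euclidean) UNIV) (PiE UNIV B)"
    using assms by (simp add: compactin_PiE)
  moreover have "PiE UNIV B = {f. \<forall>i. f i \<in> B i}" by auto
  ultimately show ?thesis
    by (simp add: euclidean_product_topology)
qed

lemma tendsto_coordinate:
  fixes f :: "'a \<Rightarrow> 'i \<Rightarrow> 'b::topological_space"
  assumes "(f \<longlongrightarrow> l) F"
  shows "((\<lambda>x. f x i) \<longlongrightarrow> l i) F"
proof (rule topological_tendstoI)
  fix S assume S: "open S" "l i \<in> S"
  have "open ((\<lambda>g::'i \<Rightarrow> 'b. g i) -` S)"
    by (rule open_vimage[OF S(1)]) simp
  from topological_tendstoD[OF assms this] S(2) show "\<forall>\<^sub>F x in F. f x i \<in> S" by simp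
qed

section \<open>Cylinder sets and the Borel structure of the space of sequences\<close>

definition cyl :: "'a list \<Rightarrow> (nat \<Rightarrow> 'a) set" where
  "cyl w = {\<omega>. map \<omega> [0..<length w] = w}"

lemma mem_cyl: "\<omega> \<in> cyl w \<longleftrightarrow> (\<forall>i<length w. \<omega> i = w ! i)"
  unfolding cyl_def mem_Collect_eq by (subst list_eq_iff_nth_eq) simp

lemma cyl_Nil [simp]: "cyl [] = UNIV"
  by (simp add: cyl_def)

lemma mem_cyl_prefix: "\<omega>' \<in> cyl (map \<omega> [0..<k]) \<longleftrightarrow> (\<forall>i<k. \<omega>' i = \<omega> i)"
  by (auto simp: mem_cyl)

lemma cyl_snoc: "\<omega> \<in> cyl (w @ [a]) \<longleftrightarrow> \<omega> \<in> cyl w \<and> \<omega> (length w) = a"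
  by (auto simp: cyl_def)

lemma cyl_Cons: "\<omega> \<in> cyl (a # w) \<longleftrightarrow> \<omega> 0 = a \<and> shift \<omega> \<in> cyl w"
  by (auto simp: mem_cyl shift_def less_Suc_eq_0_disj nth_Cons')

text \<open>If the two cylinders share a point, their intersection is the cylinder of the prefix of
  that point whose length is that of the longer word.\<close>

lemma cyl_inter: "cyl v \<inter> cyl w \<in> insert {} (range cyl)"
proof (cases "cyl v \<inter> cyl w = {}")
  case False
  then obtain \<omega> where \<omega>: "\<omega> \<in> cyl v" "\<omega> \<in> cyl w" by blast
  then have "cyl v \<inter> cyl w = cyl (map \<omega> [0..<max (length v) (length w)])"
    unfolding set_eq_iff Int_iff mem_cyl_prefix by (auto simp: mem_cyl less_max_iff_disj)
  then show ?thesis by simp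
qed simp

lemma open_cyl: "open (cyl (w :: 'a::discrete_topology list))"
proof -
  have "open {\<omega> :: nat \<Rightarrow> 'a. \<forall>i\<in>{..<length w}. \<omega> i \<in> {w ! i}}"
    by (rule product_topology_basis') (auto intro!: Topological_Spaces.open_discrete)
  moreover have "cyl w = {\<omega>. \<forall>i\<in>{..<length w}. \<omega> i \<in> {w ! i}}" by (auto simp: mem_cyl)
  ultimately show ?thesis by simp
qed

lemma cyl_borel [simp]: "cyl (w :: nat list) \<in> sets borel"
  by (simp add: open_cyl)

text \<open>A basic open set of the product topology restricts only finitely many coordinates, so a
  prefix that covers them all determines membership.\<close>

lemma cyl_neighbourhood:
  fixes S :: "(nat \<Rightarrow> 'a::discrete_topology) set"
  assumes "open S" and "\<omega> \<in> S"
  obtains k where "cyl (map \<omega> [0..<k]) \<subseteq> S"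
proof -
  have "openin (product_topology (\<lambda>i. euclidean) UNIV) S"
    using assms by (simp add: open_fun_def)
  from product_topology_open_contains_basis[OF this assms(2)] obtain Y where Y:
    "\<omega> \<in> PiE UNIV Y" "finite {i. Y i \<noteq> UNIV}" "PiE UNIV Y \<subseteq> S"
    by auto
  obtain k where k: "\<And>i. Y i \<noteq> UNIV \<Longrightarrow> i < k"
    using Y(2) finite_nat_set_iff_bounded by auto
  have "cyl (map \<omega> [0..<k]) \<subseteq> PiE UNIV Y"
  proof
    fix \<omega>' assume "\<omega>' \<in> cyl (map \<omega> [0..<k])"
    then have "\<omega>' i \<in> Y i" for i
      using Y(1) k[of i] by (cases "i < k") (auto simp: mem_cyl_prefix PiE_iff)
    then show "\<omega>' \<in> PiE UNIV Y" by auto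
  qed
  from that[OF subset_trans[OF this Y(3)]] show ?thesis .
qed

text \<open>An open set is the union of the cylinders inside it, and there are only countably many
  words.\<close>

lemma borel_eq_cylinders:
  "sets (borel :: (nat \<Rightarrow> nat) measure) = sigma_sets UNIV (insert {} (range cyl))"
  unfolding borel_def sets_measure_of_conv
proof (simp, rule sigma_sets_eqI)
  fix S :: "(nat \<Rightarrow> nat) set" assume "S \<in> Collect open"
  then have S: "open S" by simp
  have "S = (\<Union>w\<in>{w. cyl w \<subseteq> S}. cyl w)"
  proof
    show "S \<subseteq> (\<Union>w\<in>{w. cyl w \<subseteq> S}. cyl w)"
    proof
      fix \<omega> assume "\<omega> \<in> S"
      then obtain k where "cyl (map \<omega> [0..<k]) \<subseteq> S" by (rule cyl_neighbourhood[OF S])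
      moreover have "\<omega> \<in> cyl (map \<omega> [0..<k])" by (simp add: mem_cyl_prefix)
      ultimately show "\<omega> \<in> (\<Union>w\<in>{w. cyl w \<subseteq> S}. cyl w)" by blast
    qed
  qed auto
  moreover have "(\<Union>w\<in>{w. cyl w \<subseteq> S}. cyl w) \<in> sigma_sets UNIV (insert {} (range cyl))"
    by (rule sigma_sets_UNION) auto
  ultimately show "S \<in> sigma_sets UNIV (insert {} (range cyl))" by simp
qed (auto simp: open_cyl intro: sigma_sets.Empty)

lemma measure_eqI_cyl:
  fixes M N :: "(nat \<Rightarrow> nat) measure"
  assumes "sets M = sets borel" "sets N = sets borel" "finite_measure M"
    and "\<And>w. emeasure M (cyl w) = emeasure N (cyl w)"
  shows "M = N"
proof (rule measure_eqI_generator_eq)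
  interpret finite_measure M by fact
  show "Int_stable (insert {} (range (cyl :: nat list \<Rightarrow> _)))"
    using cyl_inter by (auto simp: Int_stable_def)
  show "range (\<lambda>i::nat. UNIV) \<subseteq> insert {} (range (cyl :: nat list \<Rightarrow> _))"
    by (auto intro!: image_eqI[of _ _ "[]"])
qed (use assms in \<open>auto simp: borel_eq_cylinders finite_measure.emeasure_finite\<close>)

lemma continuous_on_shift: "continuous_on UNIV shift"
  unfolding shift_def by (intro continuous_intros) simp

lemma shift_measurable [measurable]: "shift \<in> borel \<rightarrow>\<^sub>M borel"
  by (rule borel_measurable_continuous_onI[OF continuous_on_shift])

lemma shift_power_apply: "(shift ^^ m) \<omega> i = \<omega> (i + m)"
  by (induction m arbitrary: i) (auto simp: shift_def)

section \<open>Subshifts as compact shift-closed sets\<close>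

locale subshift_system =
  fixes n :: nat and X :: "(nat \<Rightarrow> nat) set"
  assumes n_ge: "n \<ge> 2" and subshift: "subshift n X"
begin

lemma nonempty: "X \<noteq> {}" and shift_closed: "\<omega> \<in> X \<Longrightarrow> shift \<omega> \<in> X"
  and symbol_less: "\<omega> \<in> X \<Longrightarrow> \<omega> i < n"
  using subshift by (auto simp: subshift_def full_shift_def alphabet_def closedin_def)

lemma shift_power_closed: "\<omega> \<in> X \<Longrightarrow> (shift ^^ m) \<omega> \<in> X"
  by (induction m) (auto intro: shift_closed)

lemma compact_X: "compact X"
proof -
  have "full_shift n = {\<omega>. \<forall>i. \<omega> i \<in> {..<n}}"
    by (simp add: full_shift_def alphabet_def)
  then have "compact (full_shift n)"
    using compact_box[of "\<lambda>_. {..<n}"] by (simp add: finite_imp_compact)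
  then show ?thesis
    using subshift unfolding subshift_def
    by (metis closed_Int_compact closedin_closed Int_commute)
qed

lemma closed_X: "closed X"
proof -
  have "closed ((\<lambda>\<omega>::nat \<Rightarrow> nat. \<omega> i) -` {..<n})" for i
    by (rule closed_vimage) (simp_all add: closed_def Topological_Spaces.open_discrete)
  moreover have "full_shift n = (\<Inter>i. (\<lambda>\<omega>. \<omega> i) -` {..<n})"
    by (auto simp: full_shift_def alphabet_def)
  ultimately have "closed (full_shift n)" by auto
  then show ?thesis
    using subshift unfolding subshift_def by (metis closedin_closed_eq)
qed

lemma borel_X: "X \<in> sets borel"
  using closed_X by simp

end

section \<open>Maximal symbol frequencies\<close>

definition occ :: "nat \<Rightarrow> nat \<Rightarrow> (nat \<Rightarrow> nat) \<Rightarrow> nat" where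
  "occ \<alpha> k \<omega> = card {i\<in>{..<k}. \<omega> i = \<alpha>}"

lemma occ_le: "occ \<alpha> k \<omega> \<le> k"
  unfolding occ_def using card_mono[of "{..<k}" "{i\<in>{..<k}. \<omega> i = \<alpha>}"] by auto

lemma occ_0 [simp]: "occ \<alpha> 0 \<omega> = 0"
  by (simp add: occ_def)

lemma occ_cong: "(\<And>i. i < k \<Longrightarrow> \<omega> i = \<omega>' i) \<Longrightarrow> occ \<alpha> k \<omega> = occ \<alpha> k \<omega>'"
  unfolding occ_def by (intro arg_cong[where f = card]) auto

lemma card_occurrences_interval:
  "card {i\<in>{m..<m + k}. \<omega> i = \<alpha>} = occ \<alpha> k ((shift ^^ m) \<omega>)"
  unfolding occ_def
  by (rule bij_betw_same_card[of "\<lambda>i. i - m"], rule bij_betw_byWitness[of _ "\<lambda>i. i + m"])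
    (auto simp: shift_power_apply)

lemma occ_add: "occ \<alpha> (m + k) \<omega> = occ \<alpha> m \<omega> + occ \<alpha> k ((shift ^^ m) \<omega>)"
proof -
  have eq: "{i\<in>{..<m + k}. \<omega> i = \<alpha>} = {i\<in>{..<m}. \<omega> i = \<alpha>} \<union> {i\<in>{m..<m + k}. \<omega> i = \<alpha>}"
    by auto
  have "card {i\<in>{..<m + k}. \<omega> i = \<alpha>} = card {i\<in>{..<m}. \<omega> i = \<alpha>} + card {i\<in>{m..<m + k}. \<omega> i = \<alpha>}"
    unfolding eq by (rule card_Un_disjoint) auto
  then show ?thesis
    unfolding card_occurrences_interval by (simp only: occ_def)
qed

lemma occ_eq_sum: "occ \<alpha> k \<omega> = (\<Sum>i<k. if \<omega> i = \<alpha> then 1 else 0)"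
  by (simp add: occ_def sum.If_cases Int_def)

text \<open>Positions start at 1 and sequences at index 0, so the window beginning at
  \<open>m\<close> is a prefix of the orbit point \<open>m - 1\<close> steps ahead.\<close>

lemma card_positions_interval:
  assumes "1 \<le> m"
  shows "card (positions \<omega> \<alpha> \<inter> {m..<m + k}) = occ \<alpha> k ((shift ^^ (m - 1)) \<omega>)"
  unfolding card_occurrences_interval[symmetric]
  using assms
  by (intro bij_betw_same_card[of "\<lambda>i. i - 1"] bij_betw_byWitness[of _ "\<lambda>i. i + 1"])
    (auto simp: positions_def)

lemma card_positions_initial: "card (positions \<omega> \<alpha> \<inter> {1..k}) = occ \<alpha> k \<omega>"
  using card_positions_interval[of 1 \<omega> \<alpha> k] by (simp add: atLeastLessThanSuc_atLeastAtMost)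

lemma upper_Banach_density_pos:
  assumes dens: "has_asymptotic_density A d" and d: "0 < d"
  shows "0 < upper_Banach_density A"
proof (rule ccontr)
  let ?F = "inf (filtercomap (\<lambda>(m, n). n - m) at_top) (principal {(m::nat, n::nat). 1 \<le> m \<and> m < n})"
  let ?f = "\<lambda>(m, n). ereal (real (card (A \<inter> {m..<n})) / real (n - m))"
  assume "\<not> ?thesis"
  then have "Limsup ?F ?f < ereal (d / 2)"
    using d unfolding upper_Banach_density_def by (auto simp: not_less elim: order.strict_trans1)
  then have "\<forall>\<^sub>F x in ?F. ?f x < ereal (d / 2)" by (rule Limsup_lessD)
  then obtain Q where Q: "eventually Q at_top"
      "\<And>m n. \<lbrakk>Q (n - m); 1 \<le> m; m < n\<rbrakk> \<Longrightarrow> ?f (m, n) < ereal (d / 2)"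
    by (auto simp: eventually_inf_principal eventually_filtercomap)
  have "\<forall>\<^sub>F k in sequentially. d / 2 < real (card (A \<inter> {1..k})) / real k"
    using dens d by (intro order_tendstoD(1)[of _ d]) (auto simp: has_asymptotic_density_def)
  then have "\<forall>\<^sub>F k::nat in sequentially. False"
    using Q(1) eventually_gt_at_top[of 0]
  proof eventually_elim
    case (elim k)
    \<comment> \<open>Initial segments are among the windows of the Banach density: the pair
      \<open>(1, k + 1)\<close> stands for \<open>{1..k}\<close>.\<close>
    have "?f (1, k + 1) < ereal (d / 2)" using elim by (intro Q(2)) auto
    moreover have "{1..<k + 1} = {1..k}" by auto
    ultimately show ?case using elim(1) by simp
  qed
  then show False by simp
qed

context subshift_system
begin

definition max_occ :: "nat \<Rightarrow> nat \<Rightarrow> nat" where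
  "max_occ \<alpha> k = Max (occ \<alpha> k ` X)"

lemma finite_occ: "finite (occ \<alpha> k ` X)"
  by (rule finite_subset[of _ "{..k}"]) (auto simp: occ_le)

lemma occ_le_max: "\<omega> \<in> X \<Longrightarrow> occ \<alpha> k \<omega> \<le> max_occ \<alpha> k"
  unfolding max_occ_def by (intro Max_ge finite_occ) auto

lemma max_occ_attained:
  obtains \<omega> where "\<omega> \<in> X" and "max_occ \<alpha> k = occ \<alpha> k \<omega>"
proof -
  have "max_occ \<alpha> k \<in> occ \<alpha> k ` X"
    unfolding max_occ_def using nonempty by (intro Max_in finite_occ) auto
  then show ?thesis using that by auto
qed

lemma max_occ_add: "max_occ \<alpha> (m + k) \<le> max_occ \<alpha> m + max_occ \<alpha> k"
proof -
  obtain \<omega> where \<omega>: "\<omega> \<in> X" "max_occ \<alpha> (m + k) = occ \<alpha> (m + k) \<omega>"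
    by (rule max_occ_attained)
  then show ?thesis
    using occ_le_max[OF \<omega>(1), of \<alpha> m] occ_le_max[OF shift_power_closed[OF \<omega>(1)], of \<alpha> k m]
    by (simp add: occ_add)
qed

definition max_freq :: "nat \<Rightarrow> real" where
  "max_freq \<alpha> = lim (\<lambda>k. real (max_occ \<alpha> k) / real k)"

text \<open>Fekete's lemma for the subadditive \<open>max_occ \<alpha>\<close>. The limit is an
  infimum, so the lower bound holds for every length and not just asymptotically.\<close>

lemma max_freq_LIMSEQ: "(\<lambda>k. real (max_occ \<alpha> k) / real k) \<longlonglongrightarrow> max_freq \<alpha>"
  and max_freq_le: "max_freq \<alpha> * real k \<le> real (max_occ \<alpha> k)"
proof -
  have "\<And>m k. real (max_occ \<alpha> (m + k)) \<le> real (max_occ \<alpha> m) + real (max_occ \<alpha> k)"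
    using max_occ_add by (simp flip: of_nat_add)
  then obtain L where L: "(\<lambda>k. real (max_occ \<alpha> k) / real k) \<longlonglongrightarrow> L"
      "\<And>k. L * real k \<le> real (max_occ \<alpha> k)"
    by (rule fekete) auto
  moreover have "max_freq \<alpha> = L"
    unfolding max_freq_def using L(1) by (rule limI)
  ultimately show "(\<lambda>k. real (max_occ \<alpha> k) / real k) \<longlonglongrightarrow> max_freq \<alpha>"
    "max_freq \<alpha> * real k \<le> real (max_occ \<alpha> k)" by auto
qed

lemma max_freq_nonneg: "0 \<le> max_freq \<alpha>"
  by (rule LIMSEQ_le_const[OF max_freq_LIMSEQ]) auto

lemma max_freq_geI:
  assumes "\<And>N. \<exists>k\<ge>N. \<exists>\<omega>\<in>X. c * real k \<le> real (occ \<alpha> k \<omega>)"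
  shows "c \<le> max_freq \<alpha>"
proof (rule ccontr)
  assume "\<not> c \<le> max_freq \<alpha>"
  then have "\<forall>\<^sub>F k in sequentially. real (max_occ \<alpha> k) / real k < c"
    using order_tendstoD(2)[OF max_freq_LIMSEQ] by simp
  then obtain N where N: "\<And>k. k \<ge> N \<Longrightarrow> real (max_occ \<alpha> k) / real k < c"
    by (auto simp: eventually_sequentially)
  obtain k \<omega> where k: "k \<ge> max N 1" "\<omega> \<in> X" "c * real k \<le> real (occ \<alpha> k \<omega>)"
    using assms by blast
  then have "c * real k \<le> real (max_occ \<alpha> k)"
    using occ_le_max[of \<omega> \<alpha> k] by linarith
  then show False
    using N[of k] k(1) by (simp add: field_simps)
qed

text \<open>If every point had a prefix of length at most \<open>N\<close> with frequency below \<open>c\<close>, cutting an orbit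
  greedily into such prefixes would bound all long frequencies by \<open>c\<close>.\<close>

lemma exists_all_prefixes_frequent:
  assumes "c < max_freq \<alpha>"
  shows "\<exists>\<omega>\<in>X. \<forall>j\<le>N. c * real j \<le> real (occ \<alpha> j \<omega>)"
proof (rule ccontr)
  assume contr: "\<not> ?thesis"
  have short: "\<exists>j\<le>N. real (occ \<alpha> j \<omega>) < c * real j" if "\<omega> \<in> X" for \<omega>
    using contr that by (auto simp: not_le)
  \<comment> \<open>Counts are nonnegative, so a prefix of frequency below \<open>c\<close> forces
    \<open>c\<close> to be positive; this absorbs the last piece of the cutting below.\<close>
  obtain \<omega>' where "\<omega>' \<in> X" using nonempty by blast
  then obtain j' where "real (occ \<alpha> j' \<omega>') < c * real j'" using short by blast
  then have "0 < c * real j'" by linarith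
  then have c: "0 \<le> c" by (simp add: zero_less_mult_iff)
  \<comment> \<open>The summand \<open>N\<close> pays for the last piece, which is too short to be
    cut and has fewer than \<open>N\<close> symbols.\<close>
  have "real (occ \<alpha> k \<omega>) \<le> c * real k + real N" if "\<omega> \<in> X" for k \<omega>
    using that
  proof (induction k arbitrary: \<omega> rule: less_induct)
    case (less k)
    obtain j where j: "j \<le> N" "real (occ \<alpha> j \<omega>) < c * real j"
      using short[OF less.prems] by blast
    have "j > 0" using j(2) by (cases j) auto
    show ?case
    proof (cases "j \<le> k")
      case True
      have "real (occ \<alpha> (k - j) ((shift ^^ j) \<omega>)) \<le> c * real (k - j) + real N"
        using True \<open>j > 0\<close> less.prems by (intro less.IH shift_power_closed) auto
      moreover have "occ \<alpha> k \<omega> = occ \<alpha> j \<omega> + occ \<alpha> (k - j) ((shift ^^ j) \<omega>)"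
        using occ_add[of \<alpha> j "k - j" \<omega>] True by simp
      ultimately show ?thesis
        using j(2) True by (simp add: of_nat_diff algebra_simps)
    next
      case False
      then have "real (occ \<alpha> k \<omega>) \<le> real N"
        using occ_le[of \<alpha> k \<omega>] j(1) by linarith
      moreover have "0 \<le> c * real k" using c by simp
      ultimately show ?thesis by linarith
    qed
  qed
  then have "max_freq \<alpha> * real k \<le> c * real k + real N" for k
    using max_freq_le[of \<alpha> k] max_occ_attained[of \<alpha> k] by (metis order_trans)
  then have bound: "(max_freq \<alpha> - c) * real k \<le> real N" for k
    by (simp add: algebra_simps)
  obtain k where "real N < real k * (max_freq \<alpha> - c)"
    using ex_less_of_nat_mult[of "max_freq \<alpha> - c" "real N"] assms by auto
  with bound[of k] show False by (simp add: mult.commute)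
qed

text \<open>Take points whose prefixes up to length \<open>N\<close> have frequency at least
  \<open>max_freq \<alpha> - 1 / (N + 1)\<close> and pass to a limit point. Its frequencies lie
  between \<open>max_freq \<alpha>\<close> and \<open>max_occ \<alpha> k / k\<close>, hence
  converge.\<close>

lemma exists_generic_point:
  obtains \<omega> where "\<omega> \<in> X" and "\<And>k. max_freq \<alpha> * real k \<le> real (occ \<alpha> k \<omega>)"
    and "(\<lambda>k. real (occ \<alpha> k \<omega>) / real k) \<longlonglongrightarrow> max_freq \<alpha>"
proof -
  let ?c = "\<lambda>N. max_freq \<alpha> - 1 / real (Suc N)"
  have "\<exists>\<omega>\<in>X. \<forall>j\<le>N. ?c N * real j \<le> real (occ \<alpha> j \<omega>)" for N
    by (rule exists_all_prefixes_frequent) simp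
  then obtain s where s: "\<And>N. s N \<in> X" "\<And>N j. j \<le> N \<Longrightarrow> ?c N * real j \<le> real (occ \<alpha> j (s N))"
    by metis
  obtain \<omega> r where r: "\<omega> \<in> X" "strict_mono r" "(s \<circ> r) \<longlonglongrightarrow> \<omega>"
    using compact_imp_seq_compact[OF compact_X] s(1) unfolding seq_compact_def by metis
  have ge: "max_freq \<alpha> * real j \<le> real (occ \<alpha> j \<omega>)" for j
  proof (rule LIMSEQ_le_const2)
    have "(\<lambda>m. inverse (real (Suc (r m)))) \<longlonglongrightarrow> 0"
      using LIMSEQ_subseq_LIMSEQ[OF LIMSEQ_inverse_real_of_nat r(2)] by (simp add: o_def)
    then have "(\<lambda>m. (max_freq \<alpha> - inverse (real (Suc (r m)))) * real j) \<longlonglongrightarrow> (max_freq \<alpha> - 0) * real j"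
      by (intro tendsto_intros)
    then show "(\<lambda>m. ?c (r m) * real j) \<longlonglongrightarrow> max_freq \<alpha> * real j"
      by (simp add: inverse_eq_divide)
    \<comment> \<open>Symbols are discrete, so convergence of a coordinate means that it is
      eventually constant; finitely many coordinates then agree simultaneously.\<close>
    have "\<forall>\<^sub>F m in sequentially. s (r m) i = \<omega> i" for i
      using tendsto_coordinate[OF r(3), of i] by (simp add: tendsto_discrete)
    then have "\<forall>\<^sub>F m in sequentially. \<forall>i\<in>{..<j}. s (r m) i = \<omega> i"
      by (intro eventually_ball_finite) auto
    moreover have "\<forall>\<^sub>F m in sequentially. j \<le> m" by (rule eventually_ge_at_top)
    ultimately have "\<forall>\<^sub>F m in sequentially. ?c (r m) * real j \<le> real (occ \<alpha> j \<omega>)"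
    proof eventually_elim
      case (elim m)
      then have "occ \<alpha> j (s (r m)) = occ \<alpha> j \<omega>" by (intro occ_cong) auto
      moreover have "j \<le> r m" using elim(2) seq_suble[OF r(2), of m] by simp
      ultimately show ?case using s(2)[of j "r m"] by simp
    qed
    then show "\<exists>N. \<forall>m\<ge>N. ?c (r m) * real j \<le> real (occ \<alpha> j \<omega>)"
      by (simp add: eventually_sequentially)
  qed
  have "(\<lambda>k. real (occ \<alpha> k \<omega>) / real k) \<longlonglongrightarrow> max_freq \<alpha>"
  proof (rule tendsto_sandwich)
    show "\<forall>\<^sub>F k in sequentially. max_freq \<alpha> \<le> real (occ \<alpha> k \<omega>) / real k"
      using eventually_gt_at_top[of 0] by eventually_elim (use ge in \<open>simp add: field_simps\<close>)
    show "\<forall>\<^sub>F k in sequentially. real (occ \<alpha> k \<omega>) / real k \<le> real (max_occ \<alpha> k) / real k"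
      using occ_le_max[OF r(1)] by (intro always_eventually allI divide_right_mono) auto
  qed (simp_all add: max_freq_LIMSEQ)
  with ge r(1) that show ?thesis by blast
qed

lemma pos_asymptotic_density_pointI:
  assumes "\<alpha> \<in> alphabet n - {0}" "0 < max_freq \<alpha>"
  shows "pos_asymptotic_density_point n X"
proof -
  obtain \<omega> where "\<omega> \<in> X" "(\<lambda>k. real (occ \<alpha> k \<omega>) / real k) \<longlonglongrightarrow> max_freq \<alpha>"
    using exists_generic_point by metis
  with assms show ?thesis
    unfolding pos_asymptotic_density_point_def has_asymptotic_density_def card_positions_initial
    by blast
qed

text \<open>Fix \<open>c\<close> strictly between 0 and the density. Every window of the point is a
  prefix of some orbit point in \<open>X\<close>; if all long prefixes had frequency below
  \<open>c\<close>, the upper Banach density would be at most \<open>c\<close>.\<close>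

lemma max_freq_pos_if_Banach_density:
  assumes "\<omega> \<in> X" and "0 < upper_Banach_density (positions \<omega> \<alpha>)"
  shows "0 < max_freq \<alpha>"
proof -
  obtain c where c: "0 < ereal c" "ereal c < upper_Banach_density (positions \<omega> \<alpha>)"
    using ereal_dense2[OF assms(2)] by auto
  have "\<exists>k\<ge>N. \<exists>\<omega>\<in>X. c * real k \<le> real (occ \<alpha> k \<omega>)" for N
  proof (rule ccontr)
    assume contr: "\<not> ?thesis"
    have short: "real (card (positions \<omega> \<alpha> \<inter> {m..<l})) / real (l - m) \<le> c"
      if "N \<le> l - m" "1 \<le> m" "m < l" for m l
    proof -
      obtain k where l: "l = m + k" using \<open>m < l\<close> less_imp_add_positive by blast
      have "\<not> c * real k \<le> real (occ \<alpha> k ((shift ^^ (m - 1)) \<omega>))"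
        using contr that l shift_power_closed[OF assms(1)] by auto
      then show ?thesis
        using that l card_positions_interval[of m \<omega> \<alpha> k] by (simp add: field_simps)
    qed
    have "upper_Banach_density (positions \<omega> \<alpha>) \<le> ereal c"
      unfolding upper_Banach_density_def
    proof (rule Limsup_bounded)
      show "\<forall>\<^sub>F x in inf (filtercomap (\<lambda>(m, n). n - m) at_top) (principal {(m, n). 1 \<le> m \<and> m < n}).
          (case x of (m, l) \<Rightarrow> ereal (real (card (positions \<omega> \<alpha> \<inter> {m..<l})) / real (l - m))) \<le> ereal c"
        unfolding eventually_inf_principal eventually_filtercomap
        by (intro exI[of _ "\<lambda>k. k \<ge> N"] conjI eventually_ge_at_top) (use short in \<open>auto simp del: of_nat_diff\<close>)
    qed
    with c(2) show False by simp
  qed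
  then have "c \<le> max_freq \<alpha>" by (rule max_freq_geI)
  with c(1) show ?thesis by simp
qed

lemma max_freq_pos_if_asymptotic_density:
  assumes "\<omega> \<in> X" and "0 < d" and "has_asymptotic_density (positions \<omega> \<alpha>) d"
  shows "0 < max_freq \<alpha>"
proof -
  have "(\<lambda>k. real (occ \<alpha> k \<omega>) / real k) \<longlonglongrightarrow> d"
    using assms(3) unfolding has_asymptotic_density_def card_positions_initial .
  then have "d \<le> max_freq \<alpha>"
    using occ_le_max[OF assms(1)]
    by (intro LIMSEQ_le[OF _ max_freq_LIMSEQ]) (auto intro!: exI divide_right_mono)
  with assms(2) show ?thesis by simp
qed

end

section \<open>Topological entropy\<close>

text \<open>A generating function: each of the \<open>k\<close> positions contributes independently
  1 for the symbol 0 and \<open>x\<close> for each of the other \<open>n - 1\<close>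
  symbols.\<close>

lemma sum_power_nonzero_symbols:
  fixes x :: real
  assumes "n \<ge> 1"
  shows "(\<Sum>w | set w \<subseteq> {..<n} \<and> length w = k. x ^ length (filter (\<lambda>a. a \<noteq> 0) w))
    = (1 + real (n - 1) * x) ^ k"
proof (induction k)
  case 0
  have "{w :: nat list. set w \<subseteq> {..<n} \<and> length w = 0} = {[]}" by auto
  then show ?case by simp
next
  case (Suc k)
  let ?W = "{w. set w \<subseteq> {..<n} \<and> length w = k}"
  let ?f = "\<lambda>w. x ^ length (filter (\<lambda>a. a \<noteq> (0::nat)) w)"
  have "(\<Sum>w | set w \<subseteq> {..<n} \<and> length w = Suc k. ?f w) = (\<Sum>(w, a)\<in>?W \<times> {..<n}. ?f (a # w))"
    unfolding lists_length_Suc_eq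
    by (subst sum.reindex) (auto simp: inj_on_def intro!: sum.cong)
  also have "\<dots> = (\<Sum>w\<in>?W. \<Sum>a<n. ?f [a] * ?f w)"
    by (subst sum.cartesian_product[symmetric]) (auto intro!: sum.cong)
  also have "\<dots> = (\<Sum>a<n. ?f [a]) * (\<Sum>w\<in>?W. ?f w)"
    by (subst sum.swap) (simp add: sum_product)
  also have "(\<Sum>a<n. ?f [a]) = 1 + real (n - 1) * x"
    using assms by (cases n) (simp_all add: sum.lessThan_Suc_shift del: sum.lessThan_Suc)
  finally show ?case using Suc by simp
qed

lemma length_filter_nonzero:
  assumes "\<And>i. i < k \<Longrightarrow> \<omega> i < n"
  shows "length (filter (\<lambda>a. a \<noteq> 0) (map \<omega> [0..<k])) = (\<Sum>\<alpha>\<in>{1..<n}. occ \<alpha> k \<omega>)"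
  using assms
proof (induction k)
  case (Suc k)
  have "(\<Sum>\<alpha>\<in>{1..<n}. if \<omega> k = \<alpha> then 1 else 0) = (if \<omega> k \<noteq> 0 then 1 else (0::nat))"
    using Suc.prems[of k] by (simp add: sum.delta')
  then show ?case
    using Suc by (simp add: occ_eq_sum sum.distrib)
qed simp

context subshift_system
begin

text \<open>Since \<open>X\<close> is closed under the shift, a block anywhere in a point is a
  prefix of another point.\<close>

lemma language_eq: "language X k = (\<lambda>\<omega>. map \<omega> [0..<k]) ` X"
proof
  show "language X k \<subseteq> (\<lambda>\<omega>. map \<omega> [0..<k]) ` X"
  proof
    fix w assume "w \<in> language X k"
    then obtain \<omega> i where \<omega>: "\<omega> \<in> X" "w = map \<omega> [i..<i + k]"
      by (auto simp: language_def)
    have "w = map ((shift ^^ i) \<omega>) [0..<k]"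
      unfolding \<omega>(2) by (rule nth_equalityI) (auto simp: shift_power_apply add.commute)
    with shift_power_closed[OF \<omega>(1)] show "w \<in> (\<lambda>\<omega>. map \<omega> [0..<k]) ` X" by blast
  qed
  show "(\<lambda>\<omega>. map \<omega> [0..<k]) ` X \<subseteq> language X k"
  proof
    fix w assume "w \<in> (\<lambda>\<omega>. map \<omega> [0..<k]) ` X"
    then obtain \<omega> where "\<omega> \<in> X" "w = map \<omega> [0..<0 + k]" by auto
    then show "w \<in> language X k" unfolding language_def by blast
  qed
qed

lemma language_subset: "language X k \<subseteq> {w. set w \<subseteq> {..<n} \<and> length w = k}"
  unfolding language_eq using symbol_less by auto

lemma finite_language: "finite (language X k)"
  using language_subset by (rule finite_subset) (simp add: finite_lists_length_eq)

lemma card_language_pos: "0 < card (language X k)"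
  using finite_language nonempty by (simp add: card_gt_0_iff language_eq)

lemma card_language_add: "card (language X (m + k)) \<le> card (language X m) * card (language X k)"
proof -
  have "card (language X (m + k)) \<le> card (language X m \<times> language X k)"
  proof (rule card_inj_on_le[of "\<lambda>w. (take m w, drop m w)"])
    show "inj_on (\<lambda>w. (take m w, drop m w)) (language X (m + k))"
      by (rule inj_onI) (metis append_take_drop_id prod.inject)
    show "(\<lambda>w. (take m w, drop m w)) ` language X (m + k) \<subseteq> language X m \<times> language X k"
    proof clarify
      fix w assume "w \<in> language X (m + k)"
      then obtain \<omega> where \<omega>: "\<omega> \<in> X" "w = map \<omega> [0..<m + k]" by (auto simp: language_eq)
      have "take m w = map \<omega> [0..<m]" by (simp add: \<omega>(2) take_map)
      moreover have "drop m w = map ((shift ^^ m) \<omega>) [0..<k]"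
        unfolding \<omega>(2) by (rule nth_equalityI) (auto simp: shift_power_apply add.commute)
      ultimately show "take m w \<in> language X m \<and> drop m w \<in> language X k"
        using \<omega>(1) shift_power_closed unfolding language_eq by blast
    qed
  qed (simp add: finite_language)
  then show ?thesis by (simp add: card_cartesian_product)
qed

lemma top_entropy_LIMSEQ:
  "(\<lambda>k. log 2 (real (card (language X k))) / real k) \<longlonglongrightarrow> top_entropy X"
proof -
  have "log 2 (real (card (language X (m + k))))
      \<le> log 2 (real (card (language X m))) + log 2 (real (card (language X k)))" for m k
  proof -
    have "log 2 (real (card (language X (m + k))))
        \<le> log 2 (real (card (language X m)) * real (card (language X k)))"
      using card_language_add[of m k] card_language_pos[of "m + k"]
      by (intro log_mono) (simp_all flip: of_nat_mult)
    also have "\<dots> = log 2 (real (card (language X m))) + log 2 (real (card (language X k)))"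
      using card_language_pos[of m] card_language_pos[of k] by (simp add: log_mult)
    finally show ?thesis .
  qed
  moreover have "0 \<le> log 2 (real (card (language X k)))" for k
    using card_language_pos[of k] by (simp add: zero_le_log_cancel_iff Suc_le_eq)
  ultimately obtain L where
      "(\<lambda>k. log 2 (real (card (language X k))) / real k) \<longlonglongrightarrow> L"
    by (rule fekete)
  then show ?thesis unfolding top_entropy_def by (metis limI)
qed

text \<open>Weighting each nonzero symbol by \<open>x\<close> replaces the usual binomial estimate of the number of
  words with few nonzero symbols.\<close>

lemma card_language_le:
  assumes "0 < x" "x \<le> (1::real)"
  shows "real (card (language X k)) * x ^ (\<Sum>\<alpha>\<in>{1..<n}. max_occ \<alpha> k) \<le> (1 + real (n - 1) * x) ^ k"
proof -
  let ?B = "\<Sum>\<alpha>\<in>{1..<n}. max_occ \<alpha> k"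
  let ?z = "\<lambda>w. length (filter (\<lambda>a. a \<noteq> (0::nat)) w)"
  have "?z w \<le> ?B" if "w \<in> language X k" for w
  proof -
    from that obtain \<omega> where \<omega>: "\<omega> \<in> X" "w = map \<omega> [0..<k]" by (auto simp: language_eq)
    have "?z w = (\<Sum>\<alpha>\<in>{1..<n}. occ \<alpha> k \<omega>)"
      unfolding \<omega>(2) using symbol_less[OF \<omega>(1)] by (rule length_filter_nonzero)
    also have "\<dots> \<le> ?B" by (intro sum_mono occ_le_max \<omega>(1))
    finally show ?thesis .
  qed
  then have "(\<Sum>w\<in>language X k. x ^ ?B) \<le> (\<Sum>w\<in>language X k. x ^ ?z w)"
    using assms by (intro sum_mono power_decreasing) auto
  then have "real (card (language X k)) * x ^ ?B \<le> (\<Sum>w\<in>language X k. x ^ ?z w)" by simp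
  also have "\<dots> \<le> (\<Sum>w | set w \<subseteq> {..<n} \<and> length w = k. x ^ ?z w)"
    using language_subset assms by (intro sum_mono2) (auto simp: finite_lists_length_eq)
  also have "\<dots> = (1 + real (n - 1) * x) ^ k"
    using n_ge by (intro sum_power_nonzero_symbols) simp
  finally show ?thesis .
qed

text \<open>Take logarithms in \<open>card_language_le\<close> and divide by \<open>k\<close>. For
  fixed \<open>x\<close> the exponent of \<open>x\<close> is of order less than \<open>k\<close>,
  because all frequencies of nonzero symbols vanish.\<close>

lemma top_entropy_le_log:
  assumes "\<And>\<alpha>. \<alpha> \<in> {1..<n} \<Longrightarrow> max_freq \<alpha> = 0" and x: "0 < x" "x \<le> (1::real)"
  shows "top_entropy X \<le> log 2 (1 + real (n - 1) * x)"
proof (rule LIMSEQ_le[OF top_entropy_LIMSEQ])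
  let ?B = "\<lambda>k. \<Sum>\<alpha>\<in>{1..<n}. max_occ \<alpha> k"
  let ?y = "1 + real (n - 1) * x"
  have y: "?y > 0" using x by (simp add: add_pos_nonneg)
  have "(\<lambda>k. \<Sum>\<alpha>\<in>{1..<n}. real (max_occ \<alpha> k) / real k) \<longlonglongrightarrow> (\<Sum>\<alpha>\<in>{1..<n}. max_freq \<alpha>)"
    by (intro tendsto_sum max_freq_LIMSEQ)
  then have "(\<lambda>k. real (?B k) / real k) \<longlonglongrightarrow> 0"
    using assms(1) by (simp add: sum_divide_distrib)
  then have "(\<lambda>k. log 2 ?y - (real (?B k) / real k) * log 2 x) \<longlonglongrightarrow> log 2 ?y - 0 * log 2 x"
    by (intro tendsto_intros)
  then show "(\<lambda>k. log 2 ?y - (real (?B k) / real k) * log 2 x) \<longlonglongrightarrow> log 2 ?y" by simp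
  show "\<exists>N. \<forall>k\<ge>N. log 2 (real (card (language X k))) / real k
      \<le> log 2 ?y - (real (?B k) / real k) * log 2 x"
  proof (intro exI[of _ 1] allI impI)
    fix k :: nat assume k: "1 \<le> k"
    have "log 2 (real (card (language X k)) * x ^ ?B k) \<le> log 2 (?y ^ k)"
      using card_language_le[OF x] card_language_pos[of k] x by (intro log_mono) auto
    then have "log 2 (real (card (language X k))) + real (?B k) * log 2 x \<le> real k * log 2 ?y"
      using card_language_pos[of k] x y by (simp add: log_mult log_nat_power del: of_nat_sum)
    then show "log 2 (real (card (language X k))) / real k
      \<le> log 2 ?y - (real (?B k) / real k) * log 2 x"
      using k by (simp add: field_simps del: of_nat_sum)
  qed
qed

lemma max_freq_pos_if_top_entropy:
  assumes h: "0 < top_entropy X"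
  shows "\<exists>\<alpha>\<in>alphabet n - {0}. 0 < max_freq \<alpha>"
proof (rule ccontr)
  assume contr: "\<not> ?thesis"
  have zero: "max_freq \<alpha> = 0" if "\<alpha> \<in> {1..<n}" for \<alpha>
  proof -
    have "\<alpha> \<in> alphabet n - {0}" using that by (auto simp: alphabet_def)
    then have "\<not> 0 < max_freq \<alpha>" using contr by blast
    with max_freq_nonneg[of \<alpha>] show ?thesis by linarith
  qed
  \<comment> \<open>With this \<open>x\<close>, the inequality \<open>ln (1 + t) \<le> t\<close>
    brings the entropy bound down to half the entropy.\<close>
  define x where "x = min 1 (top_entropy X * ln 2 / (2 * real n))"
  have x: "0 < x" "x \<le> 1" using h n_ge by (auto simp: x_def)
  have "top_entropy X \<le> log 2 (1 + real (n - 1) * x)"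
    using zero x by (rule top_entropy_le_log)
  also have "\<dots> \<le> real (n - 1) * x / ln 2"
    using x unfolding log_def by (intro divide_right_mono ln_add_one_self_le_self) auto
  also have "\<dots> \<le> real n * (top_entropy X * ln 2 / (2 * real n)) / ln 2"
    using x(1) by (intro divide_right_mono mult_mono) (auto simp: x_def)
  also have "\<dots> = top_entropy X / 2" using n_ge by simp
  finally show False using h by simp
qed

lemma hereditary_card_language_ge:
  assumes "hereditary n X" and \<alpha>: "\<alpha> \<noteq> 0"
  shows "2 ^ max_occ \<alpha> k \<le> card (language X k)"
proof -
  obtain \<omega> where \<omega>: "\<omega> \<in> X" "max_occ \<alpha> k = occ \<alpha> k \<omega>" by (rule max_occ_attained)
  define S where "S = {i\<in>{..<k}. \<omega> i = \<alpha>}"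
  define f where "f = (\<lambda>T i. if i \<in> T then 0 else \<omega> i)"
  have fX: "f T \<in> X" for T
  proof -
    have "f T \<in> full_shift n"
      using symbol_less[OF \<omega>(1)] n_ge by (auto simp: f_def full_shift_def alphabet_def)
    moreover have "\<forall>i. f T i \<le> \<omega> i" by (simp add: f_def)
    ultimately show ?thesis using assms(1) \<omega>(1) unfolding hereditary_def by blast
  qed
  have "card (Pow S) \<le> card (language X k)"
  proof (rule card_inj_on_le)
    show "inj_on (\<lambda>T. map (f T) [0..<k]) (Pow S)"
    proof (rule inj_onI)
      fix T U assume TU: "T \<in> Pow S" "U \<in> Pow S" "map (f T) [0..<k] = map (f U) [0..<k]"
      \<comment> \<open>On \<open>S\<close> the point carries the nonzero symbol \<alpha>, so the
        zeros of the modified word reveal the set of replaced positions.\<close>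
      have "i \<in> T \<longleftrightarrow> i \<in> U" if "i \<in> S" for i
      proof -
        have "f T i = f U i" using TU(3) that by (auto simp: S_def)
        with \<alpha> that show ?thesis by (auto simp: f_def S_def split: if_splits)
      qed
      with TU show "T = U" by auto
    qed
    show "(\<lambda>T. map (f T) [0..<k]) ` Pow S \<subseteq> language X k"
      using fX unfolding language_eq by blast
  qed (rule finite_language)
  then show ?thesis by (simp add: card_Pow S_def \<omega>(2) occ_def)
qed

lemma hereditary_top_entropy_ge:
  assumes "hereditary n X" "\<alpha> \<noteq> 0"
  shows "max_freq \<alpha> \<le> top_entropy X"
proof (rule LIMSEQ_le[OF max_freq_LIMSEQ top_entropy_LIMSEQ])
  have "real (max_occ \<alpha> k) \<le> log 2 (real (card (language X k)))" for k
  proof -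
    have "real (2 ^ max_occ \<alpha> k) \<le> real (card (language X k))"
      using hereditary_card_language_ge[OF assms] by (simp only: of_nat_le_iff)
    then have "log 2 (2 ^ max_occ \<alpha> k) \<le> log 2 (real (card (language X k)))"
      by (intro log_mono) auto
    then show ?thesis by (simp add: log_nat_power)
  qed
  then show "\<exists>N. \<forall>k\<ge>N. real (max_occ \<alpha> k) / real k \<le> log 2 (real (card (language X k))) / real k"
    by (auto intro!: divide_right_mono)
qed

end

section \<open>Weights of invariant measures\<close>

text \<open>\<open>D i\<close> arises from \<open>K\<close> by maximizing the coordinates
  \<open>e 0\<close>, ..., \<open>e (i - 1)\<close> one after the other. These sets are nested,
  compact and nonempty, so they have a common point.\<close>

lemma lexicographic_maximum:
  fixes K :: "('i::countable \<Rightarrow> real) set" and e :: "nat \<Rightarrow> 'i"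
  assumes "compact K" "K \<noteq> {}"
  obtains p where "p \<in> K"
    and "\<And>q i. \<lbrakk>q \<in> K; \<And>j. j < i \<Longrightarrow> q (e j) = p (e j)\<rbrakk> \<Longrightarrow> q (e i) \<le> p (e i)"
proof -
  define D where "D = rec_nat K (\<lambda>i S. {p\<in>S. \<forall>q\<in>S. q (e i) \<le> p (e i)})"
  have D0: "D 0 = K" and DSuc: "D (Suc i) = {p\<in>D i. \<forall>q\<in>D i. q (e i) \<le> p (e i)}" for i
    by (simp_all add: D_def)
  have D: "compact (D i) \<and> D i \<noteq> {}" for i
  proof (induction i)
    case (Suc i)
    have "continuous_on (D i) (\<lambda>p. p (e i))"
      by (rule continuous_on_subset[of UNIV]) simp_all
    then obtain s where s: "s \<in> D i" "\<forall>q\<in>D i. q (e i) \<le> s (e i)"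
      using continuous_attains_sup[of "D i" "\<lambda>p. p (e i)"] Suc by auto
    have "D (Suc i) = D i \<inter> {p. s (e i) \<le> p (e i)}"
      unfolding DSuc using s by (auto intro: order_trans)
    moreover have "closed {p :: 'i \<Rightarrow> real. s (e i) \<le> p (e i)}"
      by (intro closed_Collect_le continuous_intros) simp
    ultimately show ?case using s Suc by (auto intro: compact_Int_closed)
  qed (use assms in \<open>simp add: D0\<close>)
  have anti: "D j \<subseteq> D i" if "i \<le> j" for i j
    by (rule lift_Suc_antimono_le[OF _ that]) (auto simp: DSuc)
  have "K \<inter> (\<Inter>i\<in>UNIV. D i) \<noteq> {}"
  proof (rule compact_imp_fip_image[OF assms(1)])
    show "closed (D i)" for i using D compact_imp_closed by blast
    fix I :: "nat set" assume I: "finite I"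
    have "D (Max (insert 0 I)) \<subseteq> K \<inter> (\<Inter>i\<in>I. D i)"
      unfolding D0[symmetric] using anti I by (intro Int_greatest INT_greatest anti) auto
    with D show "K \<inter> (\<Inter>i\<in>I. D i) \<noteq> {}" by blast
  qed
  then obtain p where p: "\<And>i. p \<in> D i" by blast
  show ?thesis
  proof (rule that)
    show "p \<in> K" using p[of 0] by (simp add: D0)
    fix q i assume q: "q \<in> K" "\<And>j. j < i \<Longrightarrow> q (e j) = p (e j)"
    \<comment> \<open>Agreement with \<open>p\<close> in the earlier coordinates makes
      \<open>q\<close> survive each maximization, so it competes with \<open>p\<close> in
      \<open>D i\<close>.\<close>
    have "q \<in> D j" if "j \<le> i" for j
      using that
    proof (induction j)
      case (Suc j)
      then show ?case using q(2)[of j] p[of "Suc j"] by (auto simp: DSuc)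
    qed (simp add: D0 q)
    then show "q (e i) \<le> p (e i)" using p[of "Suc i"] by (auto simp: DSuc)
  qed
qed

context subshift_system
begin

text \<open>The functions \<open>w \<mapsto> \<mu> (cyl w)\<close> of the invariant measures \<open>\<mu>\<close> on \<open>X\<close>.\<close>

definition invariant_weights :: "(nat list \<Rightarrow> real) set" where
  "invariant_weights = {p. p [] = 1 \<and> (\<forall>w. p w \<in> {0..1}) \<and> (\<forall>w. cyl w \<inter> X = {} \<longrightarrow> p w = 0) \<and>
     (\<forall>w. p w = (\<Sum>a<n. p (w @ [a]))) \<and> (\<forall>w. p w = (\<Sum>a<n. p (a # w)))}"

lemma invariant_weightsD:
  assumes "p \<in> invariant_weights"
  shows "p [] = 1" "0 \<le> p w" "p w \<le> 1" "cyl w \<inter> X = {} \<Longrightarrow> p w = 0"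
    "p w = (\<Sum>a<n. p (w @ [a]))" "p w = (\<Sum>a<n. p (a # w))"
  using assms unfolding invariant_weights_def mem_Collect_eq atLeastAtMost_iff by blast+

text \<open>Inside the compact cube, each condition is an equation in finitely many coordinates and
  hence closed. The equation with \<open>w @ [a]\<close> expresses additivity, the one with
  \<open>a # w\<close> shift invariance.\<close>

lemma compact_invariant_weights: "compact invariant_weights"
proof -
  have eq: "invariant_weights = {p. \<forall>w. p w \<in> {0..1}} \<inter>
      ({p. p [] = 1} \<inter> (\<Inter>w\<in>{w. cyl w \<inter> X = {}}. {p. p w = 0}) \<inter>
       (\<Inter>w. {p. p w = (\<Sum>a<n. p (w @ [a]))}) \<inter> (\<Inter>w. {p. p w = (\<Sum>a<n. p (a # w))}))"
    unfolding invariant_weights_def by blast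
  have "compact {p :: nat list \<Rightarrow> real. \<forall>w. p w \<in> {0..1}}"
    by (rule compact_box) simp
  then show ?thesis
    unfolding eq
    by (intro compact_Int_closed closed_Int closed_INT ballI closed_Collect_eq continuous_intros)
      simp_all
qed

lemma sum_indicator_cyl_snoc:
  assumes "\<omega> \<in> X"
  shows "(\<Sum>a<n. indicator (cyl (w @ [a])) \<omega>) = (indicator (cyl w) \<omega> :: real)"
proof -
  have "(\<Sum>a<n. indicator (cyl (w @ [a])) \<omega>) =
      (\<Sum>a<n. if a = \<omega> (length w) then indicator (cyl w) \<omega> else (0::real))"
    by (intro sum.cong) (auto simp: cyl_snoc indicator_def)
  then show ?thesis using symbol_less[OF assms] by simp
qed

lemma sum_indicator_cyl_Cons:
  assumes "\<omega> \<in> X"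
  shows "(\<Sum>a<n. indicator (cyl (a # w)) \<omega>) = (indicator (cyl w) (shift \<omega>) :: real)"
proof -
  have "(\<Sum>a<n. indicator (cyl (a # w)) \<omega>) =
      (\<Sum>a<n. if a = \<omega> 0 then indicator (cyl w) (shift \<omega>) else (0::real))"
    by (intro sum.cong) (auto simp: cyl_Cons indicator_def)
  then show ?thesis using symbol_less[OF assms] by simp
qed

text \<open>The Krylov-Bogolyubov argument on the level of words: \<open>E k w\<close> is the
  frequency with which the first \<open>k + 1\<close> orbit points of a generic point visit
  \<open>cyl w\<close>, and \<open>p\<close> is an accumulation point of these functions.\<close>

lemma exists_invariant_weight_ge:
  obtains p where "p \<in> invariant_weights" and "max_freq \<alpha> \<le> p [\<alpha>]"
proof -
  obtain \<omega> where \<omega>: "\<omega> \<in> X" "\<And>k. max_freq \<alpha> * real k \<le> real (occ \<alpha> k \<omega>)"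
    using exists_generic_point[of \<alpha>] by metis
  define E where "E = (\<lambda>k w. (\<Sum>i<Suc k. indicator (cyl w) ((shift ^^ i) \<omega>)) / real (Suc k))"
  have E_box: "E k w \<in> {0..1}" for k w
  proof -
    have "(\<Sum>i<Suc k. indicator (cyl w) ((shift ^^ i) \<omega>)) \<le> (\<Sum>i<Suc k. 1::real)"
      by (intro sum_mono) (simp add: indicator_def)
    moreover have "(0::real) \<le> (\<Sum>i<Suc k. indicator (cyl w) ((shift ^^ i) \<omega>))"
      by (intro sum_nonneg) simp
    ultimately show ?thesis unfolding E_def by (simp add: divide_simps)
  qed
  have "seq_compact {p :: nat list \<Rightarrow> real. \<forall>w. p w \<in> {0..1}}"
    by (intro compact_imp_seq_compact compact_box) simp
  then obtain p r where p: "\<And>w. p w \<in> {0..1}" "strict_mono r" "(E \<circ> r) \<longlonglongrightarrow> p"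
    unfolding seq_compact_def using E_box by blast
  have lim: "(\<lambda>m. E (r m) w) \<longlonglongrightarrow> p w" for w
    using tendsto_coordinate[OF p(3), of w] by simp
  have E_snoc: "E k w = (\<Sum>a<n. E k (w @ [a]))" for k w
  proof -
    have "(\<Sum>a<n. E k (w @ [a])) =
        (\<Sum>i<Suc k. \<Sum>a<n. indicator (cyl (w @ [a])) ((shift ^^ i) \<omega>)) / real (Suc k)"
      unfolding E_def sum_divide_distrib[symmetric] by (subst sum.swap) simp
    then show ?thesis
      using sum_indicator_cyl_snoc[OF shift_power_closed[OF \<omega>(1)]] by (simp add: E_def)
  qed
  \<comment> \<open>Prepending a symbol moves the average one step along the orbit; the difference
    telescopes to two boundary terms, so invariance holds in the limit.\<close>
  have E_Cons: "\<bar>E k w - (\<Sum>a<n. E k (a # w))\<bar> \<le> inverse (real (Suc k))" for k w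
  proof -
    let ?I = "\<lambda>i. indicator (cyl w) ((shift ^^ i) \<omega>) :: real"
    have "(\<Sum>a<n. E k (a # w)) =
        (\<Sum>i<Suc k. \<Sum>a<n. indicator (cyl (a # w)) ((shift ^^ i) \<omega>)) / real (Suc k)"
      unfolding E_def sum_divide_distrib[symmetric] by (subst sum.swap) simp
    also have "\<dots> = (\<Sum>i<Suc k. ?I (Suc i)) / real (Suc k)"
      using sum_indicator_cyl_Cons[OF shift_power_closed[OF \<omega>(1)]] by simp
    finally have "E k w - (\<Sum>a<n. E k (a # w)) =
        ((\<Sum>i<Suc k. ?I i) - (\<Sum>i<Suc k. ?I (Suc i))) / real (Suc k)"
      unfolding E_def by (simp add: diff_divide_distrib)
    also have "\<dots> = (?I 0 - ?I (Suc k)) / real (Suc k)"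
      unfolding sum_subtractf[symmetric] by (subst sum_lessThan_telescope') simp
    finally have "\<bar>E k w - (\<Sum>a<n. E k (a # w))\<bar> = \<bar>?I 0 - ?I (Suc k)\<bar> / real (Suc k)"
      by simp
    also have "\<dots> \<le> 1 / real (Suc k)"
      by (intro divide_right_mono) (simp_all add: indicator_def)
    finally show ?thesis by (simp add: inverse_eq_divide)
  qed
  have "E k [] = 1" for k by (simp add: E_def field_simps)
  then have "p [] = 1" by (intro LIMSEQ_unique[OF lim]) simp
  moreover have "p w = 0" if "cyl w \<inter> X = {}" for w
  proof (rule LIMSEQ_unique[OF lim])
    have "(shift ^^ i) \<omega> \<notin> cyl w" for i using that shift_power_closed[OF \<omega>(1)] by blast
    then show "(\<lambda>m. E (r m) w) \<longlonglongrightarrow> 0" by (simp add: E_def)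
  qed
  moreover have "p w = (\<Sum>a<n. p (w @ [a]))" for w
  proof (rule LIMSEQ_unique[OF lim])
    show "(\<lambda>m. E (r m) w) \<longlonglongrightarrow> (\<Sum>a<n. p (w @ [a]))"
      unfolding E_snoc[of _ w] by (intro tendsto_sum lim)
  qed
  moreover have "p w = (\<Sum>a<n. p (a # w))" for w
  proof -
    have "(\<lambda>m. inverse (real (Suc (r m)))) \<longlonglongrightarrow> 0"
      using LIMSEQ_subseq_LIMSEQ[OF LIMSEQ_inverse_real_of_nat p(2)] by (simp add: o_def)
    then have "(\<lambda>m. E (r m) w - (\<Sum>a<n. E (r m) (a # w))) \<longlonglongrightarrow> 0"
      by (rule Lim_null_comparison[rotated]) (use E_Cons in auto)
    moreover have "(\<lambda>m. E (r m) w - (\<Sum>a<n. E (r m) (a # w))) \<longlonglongrightarrow> p w - (\<Sum>a<n. p (a # w))"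
      by (intro tendsto_diff tendsto_sum lim)
    ultimately have "p w - (\<Sum>a<n. p (a # w)) = 0" using LIMSEQ_unique by blast
    then show ?thesis by simp
  qed
  ultimately have "p \<in> invariant_weights"
    using p(1) unfolding invariant_weights_def by blast
  moreover have "max_freq \<alpha> \<le> p [\<alpha>]"
  proof (rule LIMSEQ_le_const[OF lim])
    have "max_freq \<alpha> \<le> E k [\<alpha>]" for k
    proof -
      have "E k [\<alpha>] = real (occ \<alpha> (Suc k) \<omega>) / real (Suc k)"
        unfolding E_def occ_eq_sum of_nat_sum
        by (intro arg_cong2[where f = "(/)"] sum.cong)
          (auto simp: mem_cyl shift_power_apply indicator_def)
      then show ?thesis using \<omega>(2)[of "Suc k"] by (simp add: pos_le_divide_eq)
    qed
    then show "\<exists>N. \<forall>m\<ge>N. max_freq \<alpha> \<le> E (r m) [\<alpha>]" by blast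
  qed
  ultimately show ?thesis by (rule that)
qed

end

section \<open>Measures from weights\<close>

context subshift_system
begin

context
  fixes p :: "nat list \<Rightarrow> real"
  assumes p: "p \<in> invariant_weights"
begin

text \<open>The half-open intervals \<open>{left w..<left w + p w}\<close> with \<open>w\<close> of a fixed length partition the unit
  interval in lexicographic order, and \<open>code x k\<close> is the word of length \<open>k\<close> whose interval
  contains \<open>x\<close>.\<close>

private definition left :: "nat list \<Rightarrow> real" where
  "left w = (\<Sum>j<length w. \<Sum>b<w ! j. p (take j w @ [b]))"

private primrec code :: "real \<Rightarrow> nat \<Rightarrow> nat list" where
  "code x 0 = []"
| "code x (Suc k) = code x k @ [LEAST a. x < left (code x k) + (\<Sum>b\<le>a. p (code x k @ [b]))]"

private definition point :: "real \<Rightarrow> nat \<Rightarrow> nat" where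
  "point x i = last (code x (Suc i))"

private lemma length_code [simp]: "length (code x k) = k"
  by (induction k) auto

private lemma left_Nil [simp]: "left [] = 0"
  by (simp add: left_def)

private lemma left_snoc: "left (w @ [a]) = left w + (\<Sum>b<a. p (w @ [b]))"
  by (simp add: left_def nth_append)

text \<open>The intervals are indexed by words over all natural numbers; words ending in a symbol
  outside the alphabet have cylinders that miss \<open>X\<close>, so their intervals are
  empty.\<close>

private lemma weight_out_of_alphabet: "n \<le> a \<Longrightarrow> p (w @ [a]) = 0"
  using symbol_less by (intro invariant_weightsD(4)[OF p]) (auto simp: cyl_snoc not_less[symmetric])

private lemma left_snoc_end:
  "left (w @ [a]) + p (w @ [a]) = left w + (\<Sum>b\<le>a. p (w @ [b]))"
  by (simp add: left_snoc flip: lessThan_Suc_atMost)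

text \<open>The intervals of the one-symbol extensions are stacked from \<open>left w\<close>
  upwards, and by additivity their lengths sum to \<open>p w\<close>.\<close>

private lemma interval_snoc_subset:
  "{left (w @ [a])..<left (w @ [a]) + p (w @ [a])} \<subseteq> {left w..<left w + p w}"
proof (cases "a < n")
  case True
  have "(\<Sum>b\<le>a. p (w @ [b])) \<le> (\<Sum>b<n. p (w @ [b]))"
    using True by (intro sum_mono2) (auto simp: invariant_weightsD(2)[OF p])
  then have "left (w @ [a]) + p (w @ [a]) \<le> left w + p w"
    using invariant_weightsD(5)[OF p, of w] by (simp add: left_snoc_end)
  moreover have "left w \<le> left (w @ [a])"
    by (simp add: left_snoc sum_nonneg invariant_weightsD(2)[OF p])
  ultimately show ?thesis by auto
qed (simp add: weight_out_of_alphabet)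

private lemma interval_subset: "{left w..<left w + p w} \<subseteq> {0..<1}"
proof (induction w rule: rev_induct)
  case (snoc a w)
  then show ?case using interval_snoc_subset[of w a] by (rule order_trans[rotated])
qed (simp add: invariant_weightsD(1)[OF p])

private lemma mem_interval_code:
  assumes "x \<in> {0..<1}"
  shows "x \<in> {left (code x k)..<left (code x k) + p (code x k)}"
proof (induction k)
  case 0
  then show ?case using assms by (simp add: invariant_weightsD(1)[OF p])
next
  case (Suc k)
  let ?w = "code x k"
  define P where "P = (\<lambda>a. x < left ?w + (\<Sum>b\<le>a. p (?w @ [b])))"
  define a where "a = (LEAST a. P a)"
  \<comment> \<open>The extensions up to the last symbol fill the whole interval of
    \<open>?w\<close>, so the least symbol in \<open>code\<close> exists.\<close>
  have "P (n - 1)"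
  proof -
    have "{..n - 1} = {..<n}" using n_ge by auto
    then show ?thesis
      using Suc invariant_weightsD(5)[OF p, of ?w] by (simp add: P_def)
  qed
  then have "P a" unfolding a_def by (rule LeastI)
  then have "x < left (?w @ [a]) + p (?w @ [a])"
    by (simp add: P_def left_snoc_end)
  moreover have "left (?w @ [a]) \<le> x"
  proof (cases a)
    case 0
    then show ?thesis using Suc by (simp add: left_snoc)
  next
    case (Suc a')
    then have "\<not> P a'" unfolding a_def by (intro not_less_Least) simp
    then show ?thesis
      unfolding Suc by (simp add: P_def left_snoc not_less lessThan_Suc_atMost)
  qed
  moreover have "code x (Suc k) = ?w @ [a]" by (simp add: a_def P_def)
  ultimately show ?case by simp
qed

text \<open>Converse of \<open>mem_interval_code\<close>: the interval of an extension by a symbol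
  below \<open>a\<close> ends at or before \<open>left (w @ [a])\<close>, so the interval containing
  \<open>x\<close> determines the word.\<close>

private lemma code_if_mem_interval:
  "x \<in> {left w..<left w + p w} \<Longrightarrow> code x (length w) = w"
proof (induction w rule: rev_induct)
  case (snoc a w)
  then have w: "code x (length w) = w" using interval_snoc_subset[of w a] by blast
  have "(LEAST a'. x < left w + (\<Sum>b\<le>a'. p (w @ [b]))) = a"
  proof (rule Least_equality)
    show "x < left w + (\<Sum>b\<le>a. p (w @ [b]))"
      using snoc.prems left_snoc_end[of w a] by simp
    fix a' assume a': "x < left w + (\<Sum>b\<le>a'. p (w @ [b]))"
    show "a \<le> a'"
    proof (rule ccontr)
      assume "\<not> a \<le> a'"
      then have "(\<Sum>b\<le>a'. p (w @ [b])) \<le> (\<Sum>b<a. p (w @ [b]))"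
        by (intro sum_mono2) (auto simp: invariant_weightsD(2)[OF p])
      then show False using a' snoc.prems by (simp add: left_snoc)
    qed
  qed
  then show ?case by (simp add: w)
qed simp

private lemma map_point: "map (point x) [0..<k] = code x k"
  by (induction k) (simp_all add: point_def)

private lemma point_mem_cyl_iff:
  assumes "x \<in> {0..<1}"
  shows "point x \<in> cyl w \<longleftrightarrow> x \<in> {left w..<left w + p w}"
  using mem_interval_code[OF assms, of "length w"] code_if_mem_interval[of x w]
  by (auto simp: cyl_def map_point)

private lemma point_vimage_cyl: "point -` cyl w \<inter> {0..<1} = {left w..<left w + p w}"
  using interval_subset[of w] point_mem_cyl_iff[of _ w] by auto

private lemma point_measurable: "point \<in> restrict_space lborel {0..<1} \<rightarrow>\<^sub>M borel"
proof (rule measurable_sigma_sets[OF borel_eq_cylinders])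
  fix A :: "(nat \<Rightarrow> nat) set" assume "A \<in> insert {} (range cyl)"
  then show "point -` A \<inter> space (restrict_space lborel {0..<1}) \<in> sets (restrict_space lborel {0..<1})"
    using interval_subset
    by (auto simp: space_restrict_space sets_restrict_space_iff point_vimage_cyl)
qed auto

text \<open>The measure is the image of Lebesgue measure on the unit interval under
  \<open>point\<close>: the preimage of \<open>cyl w\<close> is an interval of length
  \<open>p w\<close>.\<close>

lemma exists_measure_with_weights:
  obtains \<nu> :: "(nat \<Rightarrow> nat) measure" where "prob_space \<nu>" and "sets \<nu> = sets borel"
    and "\<And>w. measure \<nu> (cyl w) = p w"
proof -
  define \<nu> where "\<nu> = distr (restrict_space lborel {0..<1}) borel point"
  have sets: "sets \<nu> = sets borel" by (simp add: \<nu>_def)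
  have em: "emeasure \<nu> (cyl w) = ennreal (p w)" for w
  proof -
    have "emeasure \<nu> (cyl w) = emeasure (restrict_space lborel {0..<1}) {left w..<left w + p w}"
      unfolding \<nu>_def
      by (subst emeasure_distr[OF point_measurable]) (simp_all add: space_restrict_space point_vimage_cyl)
    also have "\<dots> = emeasure lborel {left w..<left w + p w}"
      using interval_subset by (intro emeasure_restrict_space) auto
    also have "\<dots> = ennreal (p w)"
      using invariant_weightsD(2)[OF p, of w] by simp
    finally show ?thesis .
  qed
  have "prob_space \<nu>"
  proof
    have "space \<nu> = cyl []" using sets_eq_imp_space_eq[OF sets] by simp
    then show "emeasure \<nu> (space \<nu>) = 1"
      using em[of "[]"] by (simp add: invariant_weightsD(1)[OF p] del: cyl_Nil)
  qed
  moreover have "measure \<nu> (cyl w) = p w" for w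
    using em[of w] invariant_weightsD(2)[OF p, of w] by (simp add: measure_def)
  ultimately show ?thesis using sets that by blast
qed

end

text \<open>The complement of \<open>X\<close> is open, hence covered by the countably many
  cylinders that miss \<open>X\<close>, all of them null.\<close>

lemma measure_outside:
  fixes \<nu> :: "(nat \<Rightarrow> nat) measure"
  assumes "sets \<nu> = sets borel" and "\<And>w. cyl w \<inter> X = {} \<Longrightarrow> emeasure \<nu> (cyl w) = 0"
  shows "emeasure \<nu> (- X) = 0"
proof -
  have open_X: "open (- X)" using closed_X by (simp add: closed_def)
  have "- X \<subseteq> (\<Union>w\<in>{w. cyl w \<inter> X = {}}. cyl w)"
  proof
    fix \<omega> assume "\<omega> \<in> - X"
    then obtain k where "cyl (map \<omega> [0..<k]) \<subseteq> - X" by (rule cyl_neighbourhood[OF open_X])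
    moreover have "\<omega> \<in> cyl (map \<omega> [0..<k])" by (simp add: mem_cyl_prefix)
    ultimately show "\<omega> \<in> (\<Union>w\<in>{w. cyl w \<inter> X = {}}. cyl w)" by blast
  qed
  moreover have "(\<Union>w\<in>{w. cyl w \<inter> X = {}}. cyl w) \<in> null_sets \<nu>"
    using assms by (intro null_sets_UN') (auto simp: null_sets_def)
  moreover have "- X \<in> sets \<nu>" using open_X assms(1) by simp
  ultimately have "- X \<in> null_sets \<nu>" by (rule null_sets_subset[rotated 2])
  then show ?thesis by (rule null_setsD1)
qed

text \<open>An invariant measure on \<open>X\<close> corresponds to an invariant Borel measure on all sequences that
  vanishes outside \<open>X\<close>.\<close>

lemma exists_invariant_measure_with_weights:
  assumes p: "p \<in> invariant_weights"
  obtains \<mu> where "invariant_measure X \<mu>" and "\<And>w. measure \<mu> (cyl w \<inter> X) = p w"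
proof -
  obtain \<nu> where \<nu>: "prob_space \<nu>" "sets \<nu> = sets borel" "\<And>w. measure \<nu> (cyl w) = p w"
    using exists_measure_with_weights[OF p] by metis
  interpret \<nu>: prob_space \<nu> by fact
  have space [simp]: "space \<nu> = UNIV" using sets_eq_imp_space_eq[OF \<nu>(2)] by simp
  have cyl_sets [simp]: "cyl w \<in> sets \<nu>" for w using \<nu>(2) by simp
  have X_sets [simp]: "X \<in> sets \<nu>" using borel_X \<nu>(2) by simp
  have shift_meas: "shift \<in> \<nu> \<rightarrow>\<^sub>M borel"
    using shift_measurable measurable_cong_sets[OF \<nu>(2) refl] by blast
  have "emeasure \<nu> (- X) = 0"
    by (rule measure_outside[OF \<nu>(2)])
      (simp add: \<nu>.emeasure_eq_measure \<nu>(3) invariant_weightsD(4)[OF p])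
  then have null: "UNIV - X \<in> null_sets \<nu>"
    using sets.compl_sets[OF X_sets] by (simp add: null_sets_def Compl_eq_Diff_UNIV)
  have on_X: "measure \<nu> (A \<inter> X) = measure \<nu> A" if "A \<in> sets \<nu>" for A
  proof -
    have "measure \<nu> (A - (UNIV - X)) = measure \<nu> A"
      by (intro measure_Diff_null_set null that)
    moreover have "A - (UNIV - X) = A \<inter> X" by auto
    ultimately show ?thesis by simp
  qed
  have vimage_sets: "shift -` A \<in> sets \<nu>" if "A \<in> sets borel" for A
    using measurable_sets[OF shift_meas that] by simp
  \<comment> \<open>It suffices to compare cylinders. Within \<open>X\<close>, the preimage of
    \<open>cyl w\<close> splits according to its first symbol, so the claim becomes the invariance
    equation of \<open>p\<close>.\<close>
  have "distr \<nu> borel shift = \<nu>"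
  proof (rule measure_eqI_cyl)
    show "finite_measure (distr \<nu> borel shift)"
      using \<nu>.prob_space_distr[OF shift_meas] by (rule prob_space.finite_measure)
    fix w
    have "measure \<nu> (shift -` cyl w) = measure \<nu> (shift -` cyl w \<inter> X)"
      by (intro on_X[symmetric] vimage_sets) simp
    also have "shift -` cyl w \<inter> X = (\<Union>a<n. cyl (a # w) \<inter> X)"
      using symbol_less by (auto simp: cyl_Cons)
    also have "measure \<nu> \<dots> = (\<Sum>a<n. measure \<nu> (cyl (a # w) \<inter> X))"
      by (rule \<nu>.finite_measure_finite_Union) (auto simp: disjoint_family_on_def cyl_Cons)
    also have "\<dots> = (\<Sum>a<n. p (a # w))" by (simp add: on_X \<nu>(3))
    also have "\<dots> = p w" by (rule invariant_weightsD(6)[OF p, symmetric])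
    finally show "emeasure (distr \<nu> borel shift) (cyl w) = emeasure \<nu> (cyl w)"
      by (subst emeasure_distr[OF shift_meas]) (simp_all add: \<nu>.emeasure_eq_measure \<nu>(3))
  qed (simp_all add: \<nu>)
  then have shift_inv: "measure \<nu> (shift -` A) = measure \<nu> A" if "A \<in> sets borel" for A
    using measure_distr[OF shift_meas that] by simp
  define \<mu> where "\<mu> = restrict_space \<nu> X"
  have \<mu>: "measure \<mu> A = measure \<nu> A" if "A \<subseteq> X" for A
    unfolding \<mu>_def using that by (intro measure_restrict_space) auto
  have sets_\<mu>: "sets \<mu> = sets (restrict_space borel X)"
    unfolding \<mu>_def by (rule sets_restrict_space_cong[OF \<nu>(2)])
  have "invariant_measure X \<mu>"
    unfolding invariant_measure_def
  proof (intro conjI ballI sets_\<mu>)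
    show "prob_space \<mu>"
      unfolding \<mu>_def using on_X[of UNIV] \<nu>.prob_space
      by (intro prob_spaceI)
        (simp add: space_restrict_space emeasure_restrict_space \<nu>.emeasure_eq_measure sets.top[of \<nu>, simplified])
    fix A assume "A \<in> sets \<mu>"
    then have A: "A \<subseteq> X" "A \<in> sets borel"
      using borel_X by (auto simp: sets_\<mu> sets_restrict_space_iff)
    have "measure \<mu> (shift -` A \<inter> X) = measure \<nu> (shift -` A)"
      using A by (simp add: \<mu> on_X vimage_sets)
    then show "measure \<mu> (shift -` A \<inter> X) = measure \<mu> A"
      using A by (simp add: \<mu> shift_inv)
  qed
  moreover have "measure \<mu> (cyl w \<inter> X) = p w" for w
    by (simp add: \<mu> on_X \<nu>(3))
  ultimately show ?thesis by (rule that)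
qed

end

section \<open>Ergodic measures\<close>

context subshift_system
begin

lemma invariant_measureD:
  assumes "invariant_measure X \<mu>"
  shows "prob_space \<mu>" "sets \<mu> = sets (restrict_space borel X)" "space \<mu> = X"
    "A \<in> sets \<mu> \<Longrightarrow> measure \<mu> (shift -` A \<inter> X) = measure \<mu> A"
    "A \<in> sets \<mu> \<longleftrightarrow> A \<in> sets borel \<and> A \<subseteq> X"
proof -
  show sets: "sets \<mu> = sets (restrict_space borel X)"
    using assms by (simp add: invariant_measure_def)
  show "space \<mu> = X"
    using sets_eq_imp_space_eq[OF sets] by (simp add: space_restrict_space)
  show "A \<in> sets \<mu> \<longleftrightarrow> A \<in> sets borel \<and> A \<subseteq> X"
    using borel_X by (simp add: sets sets_restrict_space_iff conj_commute)
qed (use assms in \<open>simp_all add: invariant_measure_def\<close>)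

lemma conditional_weights:
  assumes \<mu>: "invariant_measure X \<mu>" and A: "A \<in> sets \<mu>" "shift -` A \<inter> X = A" "0 < measure \<mu> A"
  shows "(\<lambda>w. measure \<mu> (A \<inter> cyl w) / measure \<mu> A) \<in> invariant_weights"
proof -
  interpret prob_space \<mu> using \<mu> by (rule invariant_measureD)
  note sets_iff = invariant_measureD(5)[OF \<mu>]
  have AX: "A \<subseteq> X" using A(1) by (simp add: sets_iff)
  have A_cyl: "A \<inter> cyl w \<in> sets \<mu>" for w
    using A(1) by (auto simp: sets_iff)
  have snoc: "measure \<mu> (A \<inter> cyl w) = (\<Sum>a<n. measure \<mu> (A \<inter> cyl (w @ [a])))" for w
  proof -
    have "A \<inter> cyl w = (\<Union>a<n. A \<inter> cyl (w @ [a]))"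
      using AX symbol_less by (auto simp: cyl_snoc)
    also have "measure \<mu> \<dots> = (\<Sum>a<n. measure \<mu> (A \<inter> cyl (w @ [a])))"
      by (rule finite_measure_finite_Union) (auto simp: disjoint_family_on_def cyl_snoc A_cyl)
    finally show ?thesis .
  qed
  have Cons: "measure \<mu> (A \<inter> cyl w) = (\<Sum>a<n. measure \<mu> (A \<inter> cyl (a # w)))" for w
  proof -
    have "measure \<mu> (A \<inter> cyl w) = measure \<mu> (shift -` (A \<inter> cyl w) \<inter> X)"
      by (rule invariant_measureD(4)[OF \<mu> A_cyl, symmetric])
    also have "shift -` (A \<inter> cyl w) \<inter> X = A \<inter> shift -` cyl w"
      using A(2) by auto
    also have "\<dots> = (\<Union>a<n. A \<inter> cyl (a # w))"
      using AX symbol_less by (auto simp: cyl_Cons)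
    also have "measure \<mu> \<dots> = (\<Sum>a<n. measure \<mu> (A \<inter> cyl (a # w)))"
      by (rule finite_measure_finite_Union) (auto simp: disjoint_family_on_def cyl_Cons A_cyl)
    finally show ?thesis .
  qed
  have "measure \<mu> (A \<inter> cyl w) \<le> measure \<mu> A" for w
    using A(1) by (intro finite_measure_mono) auto
  moreover have "A \<inter> cyl w = {}" if "cyl w \<inter> X = {}" for w
    using that AX by blast
  ultimately show ?thesis
    unfolding invariant_weights_def mem_Collect_eq sum_divide_distrib[symmetric]
      snoc[symmetric] Cons[symmetric]
    using A(3) by simp
qed

text \<open>The conditional measure given \<open>A\<close> agrees with \<mu> on cylinders and hence
  everywhere; evaluating both at \<open>A\<close> itself gives the claim.\<close>

lemma measure_eq_1_if_independent_of_cyl: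
  assumes \<mu>: "invariant_measure X \<mu>" and A: "A \<in> sets \<mu>" "0 < measure \<mu> A"
    and eq: "\<And>w. measure \<mu> (A \<inter> cyl w) = measure \<mu> A * measure \<mu> (cyl w \<inter> X)"
  shows "measure \<mu> A = 1"
proof -
  interpret prob_space \<mu> using \<mu> by (rule invariant_measureD)
  note sets_iff = invariant_measureD(5)[OF \<mu>] and space = invariant_measureD(3)[OF \<mu>]
  let ?U = "uniform_measure \<mu> A"
  have A': "emeasure \<mu> A \<noteq> 0" "emeasure \<mu> A \<noteq> \<infinity>" using A(2) by (auto simp: emeasure_eq_measure)
  have U: "prob_space ?U" by (rule prob_space_uniform_measure[OF A'])
  \<comment> \<open>The identity carries both measures from \<open>X\<close> to the space of all
    sequences, where \<open>measure_eqI_cyl\<close> applies.\<close>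
  have id: "(\<lambda>x. x) \<in> \<mu> \<rightarrow>\<^sub>M borel" "(\<lambda>x. x) \<in> ?U \<rightarrow>\<^sub>M borel"
    using borel_X by (auto simp: measurable_def space sets_iff)
  have "distr ?U borel (\<lambda>x. x) = distr \<mu> borel (\<lambda>x. x)"
  proof (rule measure_eqI_cyl)
    show "finite_measure (distr ?U borel (\<lambda>x. x))"
      using prob_space.prob_space_distr[OF U id(2)] by (rule prob_space.finite_measure)
    fix w :: "nat list"
    have w: "cyl w \<inter> X \<in> sets \<mu>" using sets.Int[OF cyl_borel borel_X] by (simp add: sets_iff)
    have "A \<inter> (cyl w \<inter> X) = A \<inter> cyl w" using A(1) sets_iff by blast
    then have "emeasure ?U (cyl w \<inter> X) = ennreal (measure \<mu> (A \<inter> cyl w)) / ennreal (measure \<mu> A)"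
      using A(1) w by (simp add: emeasure_uniform_measure emeasure_eq_measure)
    also have "\<dots> = ennreal (measure \<mu> (cyl w \<inter> X))"
      using A(2) by (simp add: eq divide_ennreal)
    finally show "emeasure (distr ?U borel (\<lambda>x. x)) (cyl w) = emeasure (distr \<mu> borel (\<lambda>x. x)) (cyl w)"
      using id by (simp add: emeasure_distr space emeasure_eq_measure)
  qed simp_all
  then have "emeasure (distr ?U borel (\<lambda>x. x)) A = emeasure (distr \<mu> borel (\<lambda>x. x)) A" by simp
  moreover have "A \<in> sets borel" "A \<inter> X = A" using A(1) sets_iff by auto
  ultimately have "emeasure ?U A = emeasure \<mu> A"
    using id by (simp add: emeasure_distr space)
  moreover have "emeasure ?U A = 1"
    using A A' by (simp add: emeasure_uniform_measure emeasure_eq_measure divide_ennreal)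
  ultimately show ?thesis by (simp add: emeasure_eq_measure)
qed

text \<open>A lexicographically maximal system of weights is an extreme point, so its measure cannot be
  split along an invariant set.\<close>

lemma exists_ergodic_measure:
  obtains \<mu> where "ergodic_measure X \<mu>" and "max_freq \<alpha> \<le> measure \<mu> (cylinder X \<alpha>)"
proof -
  \<comment> \<open>The word \<open>[\<alpha>]\<close> comes first, so its weight is maximal among
    all invariant weights; the remaining indices enumerate every word.\<close>
  define e where "e = case_nat [\<alpha>] (from_nat :: nat \<Rightarrow> nat list)"
  have surj_e: "\<exists>i. e i = w" for w
    by (rule exI[of _ "Suc (to_nat w)"]) (simp add: e_def)
  obtain p0 where p0: "p0 \<in> invariant_weights" "max_freq \<alpha> \<le> p0 [\<alpha>]"
    by (rule exists_invariant_weight_ge)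
  then have nonempty: "invariant_weights \<noteq> {}" by blast
  obtain p where p: "p \<in> invariant_weights"
    and max: "\<And>q i. \<lbrakk>q \<in> invariant_weights; \<And>j. j < i \<Longrightarrow> q (e j) = p (e j)\<rbrakk> \<Longrightarrow> q (e i) \<le> p (e i)"
    using lexicographic_maximum[OF compact_invariant_weights nonempty, of e] by metis
  obtain \<mu> where \<mu>: "invariant_measure X \<mu>" "\<And>w. measure \<mu> (cyl w \<inter> X) = p w"
    using exists_invariant_measure_with_weights[OF p] by metis
  interpret prob_space \<mu> using \<mu>(1) by (rule invariant_measureD)
  note sets_iff = invariant_measureD(5)[OF \<mu>(1)] and space = invariant_measureD(3)[OF \<mu>(1)]
  have "measure \<mu> A = 1" if A: "A \<in> sets \<mu>" "shift -` A \<inter> X = A" "measure \<mu> A \<noteq> 0" for A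
  proof (rule ccontr)
    assume "measure \<mu> A \<noteq> 1"
    define t where "t = measure \<mu> A"
    have t: "0 < t" "t < 1"
      using A(3) \<open>measure \<mu> A \<noteq> 1\<close> prob_le_1[of A] measure_nonneg[of \<mu> A]
      unfolding t_def by linarith+
    let ?B = "X - A"
    have B: "?B \<in> sets \<mu>" using sets.compl_sets[OF A(1)] by (simp add: space)
    have tB: "measure \<mu> ?B = 1 - t" using prob_compl[OF A(1)] by (simp add: space t_def)
    have "shift -` ?B \<inter> X = ?B" using A(2) shift_closed by blast
    then have qB: "(\<lambda>w. measure \<mu> (?B \<inter> cyl w) / (1 - t)) \<in> invariant_weights" (is "?qB \<in> _")
      using conditional_weights[OF \<mu>(1) B] tB t by simp
    have qA: "(\<lambda>w. measure \<mu> (A \<inter> cyl w) / t) \<in> invariant_weights" (is "?qA \<in> _")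
      using conditional_weights[OF \<mu>(1) A(1,2)] t by (simp add: t_def)
    have combination: "t * ?qA w + (1 - t) * ?qB w = p w" for w
    proof -
      have "cyl w \<inter> X = (A \<inter> cyl w) \<union> (?B \<inter> cyl w)" using A(1) sets_iff by blast
      moreover have "A \<inter> cyl w \<in> sets \<mu>" "?B \<inter> cyl w \<in> sets \<mu>"
        using A(1) B by (auto simp: sets_iff)
      ultimately have "p w = measure \<mu> (A \<inter> cyl w) + measure \<mu> (?B \<inter> cyl w)"
        unfolding \<mu>(2)[symmetric] by (simp only:) (rule finite_measure_Union, auto)
      then show ?thesis using t by simp
    qed
    \<comment> \<open>If both conditional weights agree with \<open>p\<close> before
      \<open>i\<close>, maximality bounds both by \<open>p\<close> at \<open>i\<close>. Their proper
      convex combination is \<open>p\<close>, so both bounds are equalities.\<close>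
    have "?qA (e i) = p (e i) \<and> ?qB (e i) = p (e i)" for i
    proof (induction i rule: less_induct)
      case (less i)
      have le: "?qA (e i) \<le> p (e i)" "?qB (e i) \<le> p (e i)"
        using max[OF qA, of i] max[OF qB, of i] less by simp_all
      then have "0 \<le> t * (p (e i) - ?qA (e i))" "0 \<le> (1 - t) * (p (e i) - ?qB (e i))"
        using t by simp_all
      moreover have "t * (p (e i) - ?qA (e i)) + (1 - t) * (p (e i) - ?qB (e i)) = 0"
        using combination[of "e i"] by (simp only: algebra_simps)
      ultimately have "t * (p (e i) - ?qA (e i)) = 0" "(1 - t) * (p (e i) - ?qB (e i)) = 0"
        by linarith+
      then show ?case using t by simp
    qed
    then have "?qA w = p w" for w using surj_e[of w] by blast
    then have "measure \<mu> (A \<inter> cyl w) = measure \<mu> A * measure \<mu> (cyl w \<inter> X)" for w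
      using t by (simp add: \<mu>(2) field_simps flip: t_def)
    then have "measure \<mu> A = 1"
      using t by (intro measure_eq_1_if_independent_of_cyl[OF \<mu>(1) A(1)]) (simp_all add: t_def)
    with t show False by (simp add: t_def)
  qed
  then have "ergodic_measure X \<mu>"
    using \<mu>(1) unfolding ergodic_measure_def by blast
  moreover have "max_freq \<alpha> \<le> measure \<mu> (cylinder X \<alpha>)"
  proof -
    have "cylinder X \<alpha> = cyl [\<alpha>] \<inter> X" by (auto simp: cylinder_def mem_cyl)
    moreover have "p0 [\<alpha>] \<le> p [\<alpha>]" using max[OF p0(1), of 0] by (simp add: e_def)
    ultimately show ?thesis using p0(2) by (simp add: \<mu>(2))
  qed
  ultimately show ?thesis by (rule that)
qed

text \<open>By invariance, the expected number of occurrences of \<alpha> among the first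
  \<open>k\<close> symbols is \<open>k\<close> times the measure of the cylinder, and it is at most
  \<open>max_occ \<alpha> k\<close>.\<close>

lemma measure_cylinder_le_max_freq:
  assumes \<mu>: "invariant_measure X \<mu>"
  shows "measure \<mu> (cylinder X \<alpha>) \<le> max_freq \<alpha>"
proof (rule LIMSEQ_le_const[OF max_freq_LIMSEQ])
  interpret prob_space \<mu> using \<mu> by (rule invariant_measureD)
  note sets_iff = invariant_measureD(5)[OF \<mu>] and space = invariant_measureD(3)[OF \<mu>]
  define C where "C = (\<lambda>i. {\<omega>\<in>X. \<omega> i = \<alpha>})"
  have C_Suc: "C (Suc i) = shift -` C i \<inter> X" for i
    using shift_closed by (auto simp: C_def shift_def)
  have C: "C i \<in> sets \<mu> \<and> measure \<mu> (C i) = measure \<mu> (cylinder X \<alpha>)" for i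
  proof (induction i)
    case 0
    have "C 0 = cyl [\<alpha>] \<inter> X" by (auto simp: C_def mem_cyl)
    moreover have "C 0 = cylinder X \<alpha>" by (simp add: C_def cylinder_def)
    moreover have "C 0 \<in> sets \<mu>"
      using sets.Int[OF cyl_borel borel_X] by (simp add: sets_iff \<open>C 0 = cyl [\<alpha>] \<inter> X\<close>)
    ultimately show ?case by simp
  next
    case (Suc i)
    have "shift -` C i \<in> sets borel"
      using measurable_sets[OF shift_measurable, of "C i"] Suc by (simp add: sets_iff)
    then have "C (Suc i) \<in> sets \<mu>"
      using borel_X by (simp add: C_Suc sets_iff)
    with Suc show ?case
      using invariant_measureD(4)[OF \<mu>, of "C i"] by (simp add: C_Suc)
  qed
  have "measure \<mu> (cylinder X \<alpha>) * real k \<le> real (max_occ \<alpha> k)" for k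
  proof -
    have "real k * measure \<mu> (cylinder X \<alpha>) = (\<Sum>i<k. measure \<mu> (C i))" using C by simp
    also have "\<dots> = (\<Sum>i<k. \<integral>\<omega>. indicator (C i) \<omega> \<partial>\<mu>)" using C by (intro sum.cong) auto
    also have "\<dots> = (\<integral>\<omega>. (\<Sum>i<k. indicator (C i) \<omega>) \<partial>\<mu>)"
      using C by (intro Bochner_Integration.integral_sum[symmetric])
        (auto simp: integrable_real_indicator emeasure_eq_measure)
    also have "\<dots> \<le> (\<integral>\<omega>. real (max_occ \<alpha> k) \<partial>\<mu>)"
    proof (rule integral_mono)
      show "integrable \<mu> (\<lambda>\<omega>. \<Sum>i<k. indicator (C i) \<omega> :: real)"
        using C by (intro Bochner_Integration.integrable_sum)
          (auto simp: integrable_real_indicator emeasure_eq_measure)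
      fix \<omega> assume "\<omega> \<in> space \<mu>"
      then have \<omega>: "\<omega> \<in> X" by (simp add: space)
      have "(\<Sum>i<k. indicator (C i) \<omega>) = real (occ \<alpha> k \<omega>)"
        unfolding occ_eq_sum of_nat_sum using \<omega> by (intro sum.cong) (auto simp: C_def)
      then show "(\<Sum>i<k. indicator (C i) \<omega>) \<le> real (max_occ \<alpha> k)"
        using occ_le_max[OF \<omega>, of \<alpha> k] by simp
    qed simp
    finally show ?thesis by (simp add: prob_space mult.commute)
  qed
  then show "\<exists>N. \<forall>k\<ge>N. measure \<mu> (cylinder X \<alpha>) \<le> real (max_occ \<alpha> k) / real k"
    by (intro exI[of _ 1]) (auto simp: pos_le_divide_eq)
qed

section \<open>Reduction of the four conditions to one common condition\<close>

definition "has_frequent_symbol \<longleftrightarrow> (\<exists>\<alpha>\<in>alphabet n - {0}. 0 < max_freq \<alpha>)"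

lemma pos_asymptotic_density_point_iff: "pos_asymptotic_density_point n X \<longleftrightarrow> has_frequent_symbol"
  unfolding has_frequent_symbol_def
  using pos_asymptotic_density_pointI max_freq_pos_if_asymptotic_density
  unfolding pos_asymptotic_density_point_def by blast

lemma pos_Banach_density_point_iff: "pos_Banach_density_point n X \<longleftrightarrow> has_frequent_symbol"
proof
  assume "pos_Banach_density_point n X"
  then show has_frequent_symbol
    unfolding pos_Banach_density_point_def has_frequent_symbol_def
    using max_freq_pos_if_Banach_density by blast
next
  assume has_frequent_symbol
  then show "pos_Banach_density_point n X"
    unfolding pos_asymptotic_density_point_iff[symmetric]
    unfolding pos_asymptotic_density_point_def pos_Banach_density_point_def
    using upper_Banach_density_pos by blast
qed

lemma pos_invariant_measureD: "pos_invariant_measure n X \<Longrightarrow> has_frequent_symbol"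
  unfolding pos_invariant_measure_def has_frequent_symbol_def
  using measure_cylinder_le_max_freq order.strict_trans2 by blast

lemma pos_ergodic_measureI: "has_frequent_symbol \<Longrightarrow> pos_ergodic_measure n X"
  unfolding pos_ergodic_measure_def has_frequent_symbol_def
  using exists_ergodic_measure order.strict_trans2 by metis

lemma pos_measure_iff:
  "pos_invariant_measure n X \<longleftrightarrow> has_frequent_symbol"
  "pos_ergodic_measure n X \<longleftrightarrow> has_frequent_symbol"
  using pos_invariant_measureD pos_ergodic_measureI
  unfolding pos_invariant_measure_def pos_ergodic_measure_def ergodic_measure_def by blast+

lemma has_frequent_symbol_if_top_entropy: "0 < top_entropy X \<Longrightarrow> has_frequent_symbol"
  unfolding has_frequent_symbol_def by (rule max_freq_pos_if_top_entropy)

lemma hereditary_has_frequent_symbol_iff: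
  "hereditary n X \<Longrightarrow> has_frequent_symbol \<longleftrightarrow> 0 < top_entropy X"
  using has_frequent_symbol_if_top_entropy hereditary_top_entropy_ge
  unfolding has_frequent_symbol_def by (blast intro: order.strict_trans2)

end

theorem theorem13:
  fixes n :: nat and X :: "(nat \<Rightarrow> nat) set"
  assumes "n \<ge> 2" and "subshift n X"
  shows
    "(pos_Banach_density_point n X \<longleftrightarrow> pos_invariant_measure n X) \<and>
     (pos_invariant_measure n X \<longleftrightarrow> pos_ergodic_measure n X) \<and>
     (pos_ergodic_measure n X \<longleftrightarrow> pos_asymptotic_density_point n X) \<and>
     (top_entropy X > 0 \<longrightarrow>
        pos_Banach_density_point n X \<and> pos_invariant_measure n X \<and>
        pos_ergodic_measure n X \<and> pos_asymptotic_density_point n X) \<and>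
     (hereditary n X \<longrightarrow>
        (pos_Banach_density_point n X \<longleftrightarrow> top_entropy X > 0) \<and>
        (pos_invariant_measure n X \<longleftrightarrow> top_entropy X > 0) \<and>
        (pos_ergodic_measure n X \<longleftrightarrow> top_entropy X > 0) \<and>
        (pos_asymptotic_density_point n X \<longleftrightarrow> top_entropy X > 0))"
proof -
  interpret subshift_system n X
    using assms by unfold_locales
  show ?thesis
    unfolding pos_Banach_density_point_iff pos_measure_iff pos_asymptotic_density_point_iff
    using has_frequent_symbol_if_top_entropy hereditary_has_frequent_symbol_iff by simp
qed

end
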